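(* Let $a\in\mathbb{R}$ be quadratic (a solution of a quadratic equation with rational coefficients). Then the two-sorted structure $\mathcal{B}=(\mathbb{N},\mathcal{P}(\mathbb{N}),s_{\mathbb{N}},\in)$ defines an isomorphic copy of $\mathcal{R}_a=(\mathbb{R},<,+,\mathbb{Z},\mathbb{Z}a)$; that is, there is a structure whose universe, order, addition and two distinguished subsets are all definable without parameters in $\mathcal{B}$ (with the universe a definable subset of a finite product of the sorts $\mathbb{N}$ and $\mathcal{P}(\mathbb{N})$) and which is isomorphic to $\mathcal{R}_a$.
   Context: $\mathcal{B}$ is the structure of monadic second order logic of one successor: its sorts are $\mathbb{N}=\{0,1,2,\dots\}$ and the power set $\mathcal{P}(\mathbb{N})$, $s_{\mathbb{N}}$ is the successor function on $\mathbb{N}$, and $\in\subseteq\mathbb{N}\times\mathcal{P}(\mathbb{N})$ is membership. $\mathcal{R}_a$ is the expansion of $(\mathbb{R},<,+)$ by unary predicates for $\mathbb{Z}$ and $\mathbb{Z}a=\{za:z\in\mathbb{Z}\}$. *)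

theory Defs
  imports Complex_Main
begin

text \<open>
  The structure \<open>\<B> = (\<nat>, \<P>(\<nat>), s\<^sub>\<nat>, \<in>)\<close> and first-order formulas over its
  two-sorted signature, with equality on both sorts.  Number variables and set variables
  live in separate name spaces, so every formula is well-sorted by construction.
\<close>

datatype nterm = NVar nat | Succ nterm

datatype fm =
    EqN nterm nterm
  | EqS nat nat
  | Mem nterm nat
  | Neg fm
  | Conj fm fm
  | ExN nat fm
  | ExS nat fm

primrec nterm_val :: "(nat \<Rightarrow> nat) \<Rightarrow> nterm \<Rightarrow> nat" where
  "nterm_val e (NVar i) = e i"
| "nterm_val e (Succ t) = Suc (nterm_val e t)"

primrec sat :: "(nat \<Rightarrow> nat) \<Rightarrow> (nat \<Rightarrow> nat set) \<Rightarrow> fm \<Rightarrow> bool" where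
  "sat e E (EqN s t) \<longleftrightarrow> nterm_val e s = nterm_val e t"
| "sat e E (EqS i j) \<longleftrightarrow> E i = E j"
| "sat e E (Mem t i) \<longleftrightarrow> nterm_val e t \<in> E i"
| "sat e E (Neg \<phi>) \<longleftrightarrow> \<not> sat e E \<phi>"
| "sat e E (Conj \<phi> \<psi>) \<longleftrightarrow> sat e E \<phi> \<and> sat e E \<psi>"
| "sat e E (ExN i \<phi>) \<longleftrightarrow> (\<exists>n. sat (e(i := n)) E \<phi>)"
| "sat e E (ExS i \<phi>) \<longleftrightarrow> (\<exists>X. sat e (E(i := X)) \<phi>)"

primrec nterm_vars :: "nterm \<Rightarrow> nat set" where
  "nterm_vars (NVar i) = {i}"
| "nterm_vars (Succ t) = nterm_vars t"

primrec free_nvars :: "fm \<Rightarrow> nat set" where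
  "free_nvars (EqN s t) = nterm_vars s \<union> nterm_vars t"
| "free_nvars (EqS i j) = {}"
| "free_nvars (Mem t i) = nterm_vars t"
| "free_nvars (Neg \<phi>) = free_nvars \<phi>"
| "free_nvars (Conj \<phi> \<psi>) = free_nvars \<phi> \<union> free_nvars \<psi>"
| "free_nvars (ExN i \<phi>) = free_nvars \<phi> - {i}"
| "free_nvars (ExS i \<phi>) = free_nvars \<phi>"

primrec free_svars :: "fm \<Rightarrow> nat set" where
  "free_svars (EqN s t) = {}"
| "free_svars (EqS i j) = {i, j}"
| "free_svars (Mem t i) = {i}"
| "free_svars (Neg \<phi>) = free_svars \<phi>"
| "free_svars (Conj \<phi> \<psi>) = free_svars \<phi> \<union> free_svars \<psi>"
| "free_svars (ExN i \<phi>) = free_svars \<phi>"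
| "free_svars (ExS i \<phi>) = free_svars \<phi> - {i}"

datatype srt = SNat | SSet

datatype elem = ENat (the_nat: nat) | ESet (the_set: "nat set")

primrec srt_of :: "elem \<Rightarrow> srt" where
  "srt_of (ENat n) = SNat"
| "srt_of (ESet X) = SSet"

text \<open>
  A list \<open>w\<close> of sorts stands for the product of these sorts, in the given order;
  its elements are the lists of elements with sorts \<open>w\<close>.
\<close>

definition tuples :: "srt list \<Rightarrow> elem list set" where
  "tuples w = {v. map srt_of v = w}"

text \<open>
  Parameter-free definability of a subset of a product.  The coordinate with index \<open>i\<close>
  is denoted by the variable \<open>i\<close> of the matching sort; by the conditions on the free
  variables, coordinates are only ever read at their own sort, and positions outside the
  tuple are not read at all.
\<close>

definition definable :: "srt list \<Rightarrow> elem list set \<Rightarrow> bool" where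
  "definable w R \<longleftrightarrow>
    (\<exists>\<phi>. (\<forall>i\<in>free_nvars \<phi>. i < length w \<and> w ! i = SNat) \<and>
         (\<forall>i\<in>free_svars \<phi>. i < length w \<and> w ! i = SSet) \<and>
         R = {v \<in> tuples w. sat (\<lambda>i. the_nat (v ! i)) (\<lambda>i. the_set (v ! i)) \<phi>})"

text \<open>
  Structures in the signature of \<open>\<R>\<^sub>a\<close>: an order, an addition and two unary predicates.
\<close>

record 'a ogrp2 =
  univ :: "'a set"
  lt :: "'a \<Rightarrow> 'a \<Rightarrow> bool"
  add :: "'a \<Rightarrow> 'a \<Rightarrow> 'a"
  pred1 :: "'a set"
  pred2 :: "'a set"

definition is_structure :: "'a ogrp2 \<Rightarrow> bool" where
  "is_structure A \<longleftrightarrow>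
    (\<forall>x\<in>univ A. \<forall>y\<in>univ A. add A x y \<in> univ A) \<and>
    pred1 A \<subseteq> univ A \<and> pred2 A \<subseteq> univ A"

definition isomorphic :: "'a ogrp2 \<Rightarrow> 'b ogrp2 \<Rightarrow> bool" where
  "isomorphic A B \<longleftrightarrow>
    (\<exists>f. bij_betw f (univ A) (univ B) \<and>
         (\<forall>x\<in>univ A. \<forall>y\<in>univ A. lt A x y \<longleftrightarrow> lt B (f x) (f y)) \<and>
         (\<forall>x\<in>univ A. \<forall>y\<in>univ A. f (add A x y) = add B (f x) (f y)) \<and>
         (\<forall>x\<in>univ A. x \<in> pred1 A \<longleftrightarrow> f x \<in> pred1 B) \<and>
         (\<forall>x\<in>univ A. x \<in> pred2 A \<longleftrightarrow> f x \<in> pred2 B))"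

text \<open>
  A structure is definable in \<open>\<B>\<close> if its universe is a definable subset of a product of
  sorts, and its order, the graph of its addition, and its two predicates are definable.
  Pairs and triples of tuples are flattened by concatenation.
\<close>

definition definable_structure :: "elem list ogrp2 \<Rightarrow> bool" where
  "definable_structure A \<longleftrightarrow> is_structure A \<and>
    (\<exists>w. definable w (univ A) \<and>
         definable (w @ w) {x @ y | x y. x \<in> univ A \<and> y \<in> univ A \<and> lt A x y} \<and>
         definable (w @ w @ w) {x @ y @ add A x y | x y. x \<in> univ A \<and> y \<in> univ A} \<and>
         definable w (pred1 A) \<and>
         definable w (pred2 A))"

definition R_struct :: "real \<Rightarrow> real ogrp2" where
  "R_struct a = \<lparr>univ = UNIV, lt = (<), add = (+),
                 pred1 = \<int>, pred2 = {of_int z * a | z. True}\<rparr>"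

text \<open>Rational \<open>a\<close> are included: they solve \<open>(x - a)\<^sup>2 = 0\<close>.\<close>

definition quadratic :: "real \<Rightarrow> bool" where
  "quadratic a \<longleftrightarrow>
    (\<exists>p q r :: rat. p \<noteq> 0 \<and> of_rat p * a^2 + of_rat q * a + of_rat r = 0)"

end

theory Submission
  imports Defs "HOL-Analysis.Kronecker_Approximation_Theorem" "HOL-Library.Multiset"
begin

text \<open>
  Pell's equation provides a unit \<open>\<beta> > 1\<close> with \<open>\<beta>\<^sup>2 = t \<beta> - 1\<close> and integers with \<open>m a = n + k \<beta>\<close>,
  \<open>m \<noteq> 0\<close>. Reals are coded by their expansions in base \<open>\<beta>\<close> with bounded integer digits, that is,
  by words over a finite alphabet indexed by \<open>\<int>\<close>. A fixed integer combination of words has value 0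
  iff the Horner states of its evaluation stay bounded; these states lie in \<open>\<int> + \<int> \<beta>\<close> and have
  bounded conjugates as well, so they range over a finite set and a run through them is a set
  quantifier. Hence addition and order are definable, and the expansions obtained by rounding to the
  nearest are a definable set of unique codes. As the conjugate of \<open>\<beta>\<close> is \<open>1 / \<beta>\<close>, conjugation of a
  finite expansion reverses the word, so the integers are the values of finite words that do not
  change under reversal. Multiplication by \<open>\<beta>\<close> shifts a word, which yields \<open>\<int> a\<close> from \<open>\<int>\<close>.
\<close>

section \<open>Relations definable by formulas\<close>

text \<open>Two obstacles shape the choice of base. Equality of values must be recognizable with
  finite memory: multiplication by \<beta> shrinks conjugates, so bounded digits keep the conjugates
  of the Horner states bounded, and elements bounded in both embeddings are finitely many lattice
  points. The number a itself gives no such base, but a unit linked to it by an integer relation is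
  enough; for rational a any unit serves, with k = 0. The other obstacle is \<int>, which is not
  visible in base \<beta> digits: finite words represent elements of \<int> + \<int> \<beta>, and
  what singles out the integers there is equality with the conjugate. Reversal expresses conjugation
  without signs only because the norm is +1 and not -1.

  Carrying is never described. Words are combined digit by digit, digits may leave the alphabet, and
  every arithmetic statement becomes a zero test or a sign test for such a combination. Codes have
  to be unique because an isomorphism identifies codes only when they are equal, not when their
  values are.\<close>

definition mso :: "((nat \<Rightarrow> nat) \<Rightarrow> (nat \<Rightarrow> nat set) \<Rightarrow> bool) \<Rightarrow> bool" where
  "mso P \<longleftrightarrow> (\<exists>\<phi>. \<forall>e E. sat e E \<phi> \<longleftrightarrow> P e E)"

lemma msoI: "(\<And>e E. sat e E \<phi> \<longleftrightarrow> P e E) \<Longrightarrow> mso P"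
  unfolding mso_def by blast

lemma finite_free_vars: "finite (free_nvars \<phi>)" "finite (free_svars \<phi>)"
proof -
  have *: "finite (nterm_vars s)" for s by (induction s) auto
  show "finite (free_nvars \<phi>)" by (induction \<phi>) (auto simp: *)
  show "finite (free_svars \<phi>)" by (induction \<phi>) auto
qed

lemma nterm_val_cong:
  "(\<And>i. i \<in> nterm_vars s \<Longrightarrow> e i = e' i) \<Longrightarrow> nterm_val e s = nterm_val e' s"
  by (induction s) auto

lemma sat_cong:
  assumes "\<And>i. i \<in> free_nvars \<phi> \<Longrightarrow> e i = e' i" "\<And>i. i \<in> free_svars \<phi> \<Longrightarrow> E i = E' i"
  shows "sat e E \<phi> \<longleftrightarrow> sat e' E' \<phi>"
  using assms
proof (induction \<phi> arbitrary: e e' E E')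
  case (EqN s t)
  then show ?case
    using nterm_val_cong[of s e e'] nterm_val_cong[of t e e'] by simp
next
  case (Mem s i)
  then show ?case using nterm_val_cong[of s e e'] by simp
next
  case (Neg \<phi>)
  have "sat e E \<phi> \<longleftrightarrow> sat e' E' \<phi>" by (rule Neg.IH) (use Neg.prems in auto)
  then show ?case by simp
next
  case (Conj \<phi> \<psi>)
  have "sat e E \<phi> \<longleftrightarrow> sat e' E' \<phi>" by (rule Conj.IH) (use Conj.prems in auto)
  moreover have "sat e E \<psi> \<longleftrightarrow> sat e' E' \<psi>" by (rule Conj.IH) (use Conj.prems in auto)
  ultimately show ?case by simp
next
  case (ExN k \<phi>)
  have "sat (e(k := n)) E \<phi> \<longleftrightarrow> sat (e'(k := n)) E' \<phi>" for n
    by (rule ExN.IH) (use ExN.prems in auto)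
  then show ?case by simp
next
  case (ExS k \<phi>)
  have "sat e (E(k := X)) \<phi> \<longleftrightarrow> sat e' (E'(k := X)) \<phi>" for X
    by (rule ExS.IH) (use ExS.prems in auto)
  then show ?case by simp
qed auto

primrec rename_nterm :: "(nat \<Rightarrow> nat) \<Rightarrow> nterm \<Rightarrow> nterm" where
  "rename_nterm \<rho> (NVar i) = NVar (\<rho> i)"
| "rename_nterm \<rho> (Succ t) = Succ (rename_nterm \<rho> t)"

lemma nterm_val_rename: "nterm_val e (rename_nterm \<rho> t) = nterm_val (\<lambda>i. e (\<rho> i)) t"
  by (induction t) auto

text \<open>Stating existence avoids a capture-avoiding substitution function. The induction is over
  all \<rho> and \<sigma>, injective or not, and a bound variable is moved to an index to which no
  free variable of the body is mapped.\<close>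

lemma sat_rename:
  "\<exists>\<psi>. \<forall>e E. sat e E \<psi> \<longleftrightarrow> sat (\<lambda>i. e (\<rho> i)) (\<lambda>i. E (\<sigma> i)) \<phi>"
proof (induction \<phi> arbitrary: \<rho> \<sigma>)
  case (EqN s t)
  show ?case by (rule exI[of _ "EqN (rename_nterm \<rho> s)
        (rename_nterm \<rho> t)"]) (simp add: nterm_val_rename)
next
  case (EqS i j)
  show ?case by (rule exI[of _ "EqS (\<sigma> i) (\<sigma> j)"]) simp
next
  case (Mem s j)
  show ?case by (rule exI[of _ "Mem (rename_nterm \<rho> s) (\<sigma> j)"])
      (simp add: nterm_val_rename)
next
  case (Neg \<phi>)
  obtain \<psi> where "\<forall>e E. sat e E \<psi> \<longleftrightarrow> sat (\<lambda>i. e (\<rho> i)) (\<lambda>i. E (\<sigma> i)) \<phi>"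
    using Neg.IH[of \<rho> \<sigma>] by (elim exE)
  then show ?case by (intro exI[of _ "Neg \<psi>"]) simp
next
  case (Conj \<phi>1 \<phi>2)
  obtain \<psi>1 where "\<forall>e E. sat e E \<psi>1 \<longleftrightarrow> sat (\<lambda>i. e (\<rho> i)) (\<lambda>i. E (\<sigma> i)) \<phi>1"
    using Conj.IH(1)[of \<rho> \<sigma>] by (elim exE)
  moreover obtain \<psi>2 where
    "\<forall>e E. sat e E \<psi>2 \<longleftrightarrow> sat (\<lambda>i. e (\<rho> i)) (\<lambda>i. E (\<sigma> i)) \<phi>2"
    using Conj.IH(2)[of \<rho> \<sigma>] by (elim exE)
  ultimately show ?case by (intro exI[of _ "Conj \<psi>1 \<psi>2"]) simp
next
  case (ExN j \<phi>)
  obtain k where k: "k \<notin> \<rho> ` free_nvars \<phi>"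
    using ex_new_if_finite finite_free_vars infinite_UNIV_nat by blast
  obtain \<psi> where \<psi>: "\<forall>e E. sat e E \<psi> \<longleftrightarrow>
      sat (\<lambda>i. e ((\<rho>(j := k)) i)) (\<lambda>i. E (\<sigma> i)) \<phi>"
    using ExN.IH[of "\<rho>(j := k)" \<sigma>] by (elim exE)
  have "sat (\<lambda>i. (e(k := n)) ((\<rho>(j := k)) i)) (\<lambda>i. E (\<sigma> i)) \<phi> \<longleftrightarrow>
      sat ((\<lambda>i. e (\<rho> i))(j := n)) (\<lambda>i. E (\<sigma> i)) \<phi>" for e E n
    by (rule sat_cong) (use k in auto)
  with \<psi> show ?case by (intro exI[of _ "ExN k \<psi>"]) simp
next
  case (ExS j \<phi>)
  obtain k where k: "k \<notin> \<sigma> ` free_svars \<phi>"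
    using ex_new_if_finite finite_free_vars infinite_UNIV_nat by blast
  obtain \<psi> where \<psi>: "\<forall>e E. sat e E \<psi> \<longleftrightarrow>
      sat (\<lambda>i. e (\<rho> i)) (\<lambda>i. E ((\<sigma>(j := k)) i)) \<phi>"
    using ExS.IH[of \<rho> "\<sigma>(j := k)"] by (elim exE)
  have "sat (\<lambda>i. e (\<rho> i)) (\<lambda>i. (E(k := X)) ((\<sigma>(j := k)) i)) \<phi> \<longleftrightarrow>
      sat (\<lambda>i. e (\<rho> i)) ((\<lambda>i. E (\<sigma> i))(j := X)) \<phi>" for e E X
    by (rule sat_cong) (use k in auto)
  with \<psi> show ?case by (intro exI[of _ "ExS k \<psi>"]) simp
qed

section \<open>Closure of definable relations under connectives and quantifiers\<close>

lemma mso_rename: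
  assumes "mso P"
  shows "mso (\<lambda>e E. P (\<lambda>i. e (\<rho> i)) (\<lambda>i. E (\<sigma> i)))"
proof -
  obtain \<phi> where "\<And>e E. sat e E \<phi> \<longleftrightarrow> P e E" using assms unfolding mso_def by blast
  with sat_rename[of \<rho> \<sigma> \<phi>] show ?thesis unfolding mso_def by simp
qed

lemma mso_eq: "mso (\<lambda>e E. e i = e j)"
  by (rule msoI[of "EqN (NVar i) (NVar j)"]) simp

lemma mso_eq_Suc: "mso (\<lambda>e E. e i = Suc (e j))"
  by (rule msoI[of "EqN (NVar i) (Succ (NVar j))"]) simp

lemma mso_mem: "mso (\<lambda>e E. e i \<in> E j)"
  by (rule msoI[of "Mem (NVar i) j"]) simp

lemma mso_Suc_mem: "mso (\<lambda>e E. Suc (e i) \<in> E j)"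
  by (rule msoI[of "Mem (Succ (NVar i)) j"]) simp

lemma mso_not:
  assumes "mso P"
  shows "mso (\<lambda>e E. \<not> P e E)"
proof -
  obtain \<phi> where "\<And>e E. sat e E \<phi> \<longleftrightarrow> P e E" using assms unfolding mso_def by blast
  then show ?thesis by (intro msoI[of "Neg \<phi>"]) simp
qed

lemma mso_conj:
  assumes "mso P" "mso Q"
  shows "mso (\<lambda>e E. P e E \<and> Q e E)"
proof -
  obtain \<phi> \<psi> where "\<forall>e E. sat e E \<phi> \<longleftrightarrow> P e E" "\<forall>e E. sat e E \<psi> \<longleftrightarrow> Q e E"
    using assms unfolding mso_def by (elim exE)
  then show ?thesis by (intro msoI[of "Conj \<phi> \<psi>"]) simp
qed

lemma mso_disj:
  assumes "mso P" "mso Q"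
  shows "mso (\<lambda>e E. P e E \<or> Q e E)"
  using mso_not[OF mso_conj[OF mso_not[OF assms(1)] mso_not[OF assms(2)]]]
  by (simp only: de_Morgan_conj not_not)

lemma mso_imp:
  assumes "mso P" "mso Q"
  shows "mso (\<lambda>e E. P e E \<longrightarrow> Q e E)"
  using mso_disj[OF mso_not[OF assms(1)] assms(2)] by (simp only: imp_conv_disj)

lemma mso_iff:
  assumes "mso P" "mso Q"
  shows "mso (\<lambda>e E. P e E \<longleftrightarrow> Q e E)"
  using mso_conj[OF mso_imp[OF assms] mso_imp[OF assms(2,1)]]
  by (simp only: iff_conv_conj_imp)

lemma mso_const: "mso (\<lambda>e E. b)"
  using mso_eq[of 0 0] mso_not[OF mso_eq[of 0 0]] by (cases b) simp_all

text \<open>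
  Environments are used in the style of de Bruijn: a quantified variable is passed to the body at
  index 0, and the other variables of its sort are shifted.
\<close>

lemma mso_exN:
  assumes "mso (\<lambda>e E. P (e 0) (\<lambda>i. e (Suc i)) E)"
  shows "mso (\<lambda>e E. \<exists>n. P n e E)"
proof -
  obtain \<phi> where \<phi>: "\<And>e E. sat e E \<phi> \<longleftrightarrow> P (e 0) (\<lambda>i. e (Suc i)) E"
    using assms unfolding mso_def by blast
  \<comment> \<open>A free variable \<open>i > 0\<close> of \<phi> denotes entry
    \<open>i - 1\<close> of the outer environment; the index bound by the new quantifier must avoid
    all of these entries.\<close>
  obtain k where k: "k \<notin> (\<lambda>i. i - 1) ` free_nvars \<phi>"
    using ex_new_if_finite finite_free_vars infinite_UNIV_nat by blast
  obtain \<psi> where \<psi>: "\<forall>e E. sat e E \<psi> \<longleftrightarrow> sat (\<lambda>i. e (case_nat k id i)) (\<lambda>i. E (id i)) \<phi>"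
    using sat_rename by blast
  have "sat (\<lambda>i. (e(k := n)) (case_nat k id i)) E \<phi> \<longleftrightarrow> sat (case_nat n e) E \<phi>" for e E n
  proof (rule sat_cong)
    fix i assume "i \<in> free_nvars \<phi>"
    then have "i - 1 \<noteq> k" using k by blast
    then show "(e(k := n)) (case_nat k id i) = case_nat n e i" by (cases i) auto
  qed simp
  then show ?thesis by (intro msoI[of "ExN k \<psi>"]) (simp add: \<psi> \<phi>)
qed

lemma mso_exS:
  assumes "mso (\<lambda>e E. P (E 0) e (\<lambda>i. E (Suc i)))"
  shows "mso (\<lambda>e E. \<exists>X. P X e E)"
proof -
  obtain \<phi> where \<phi>: "\<And>e E. sat e E \<phi> \<longleftrightarrow> P (E 0) e (\<lambda>i. E (Suc i))"
    using assms unfolding mso_def by blast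
  obtain k where k: "k \<notin> (\<lambda>i. i - 1) ` free_svars \<phi>"
    using ex_new_if_finite finite_free_vars infinite_UNIV_nat by blast
  obtain \<psi> where \<psi>: "\<forall>e E. sat e E \<psi> \<longleftrightarrow> sat (\<lambda>i. e (id i)) (\<lambda>i. E (case_nat k id i)) \<phi>"
    using sat_rename by blast
  have "sat e (\<lambda>i. (E(k := X)) (case_nat k id i)) \<phi> \<longleftrightarrow> sat e (case_nat X E) \<phi>" for e E X
  proof (rule sat_cong)
    fix i assume "i \<in> free_svars \<phi>"
    then have "i - 1 \<noteq> k" using k by blast
    then show "(E(k := X)) (case_nat k id i) = case_nat X E i" by (cases i) auto
  qed simp
  then show ?thesis by (intro msoI[of "ExS k \<psi>"]) (simp add: \<psi> \<phi>)
qed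

lemma mso_allN:
  assumes "mso (\<lambda>e E. P (e 0) (\<lambda>i. e (Suc i)) E)"
  shows "mso (\<lambda>e E. \<forall>n. P n e E)"
  using mso_not[OF mso_exN[of "\<lambda>n e E. \<not> P n e E", OF mso_not[OF assms]]]
  by (simp only: not_ex not_not)

lemma mso_allS:
  assumes "mso (\<lambda>e E. P (E 0) e (\<lambda>i. E (Suc i)))"
  shows "mso (\<lambda>e E. \<forall>X. P X e E)"
  using mso_not[OF mso_exS[of "\<lambda>X e E. \<not> P X e E", OF mso_not[OF assms]]]
  by (simp only: not_ex not_not)

lemma mso_ball_finite:
  assumes "finite A" "\<And>x. x \<in> A \<Longrightarrow> mso (P x)"
  shows "mso (\<lambda>e E. \<forall>x\<in>A. P x e E)"
  using assms
proof (induction A)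
  case empty
  show ?case using mso_const[of True] by (simp only: ball_simps)
next
  case (insert x A)
  have "mso (P x)" using insert.prems by blast
  moreover have "mso (\<lambda>e E. \<forall>x\<in>A. P x e E)"
    by (rule insert.IH) (use insert.prems in blast)
  ultimately show ?case unfolding ball_simps by (rule mso_conj)
qed

lemma mso_bex_finite:
  assumes "finite A" "\<And>x. x \<in> A \<Longrightarrow> mso (P x)"
  shows "mso (\<lambda>e E. \<exists>x\<in>A. P x e E)"
proof -
  have "mso (\<lambda>e E. \<not> (\<forall>x\<in>A. \<not> P x e E))"
    using assms by (intro mso_not mso_ball_finite) blast+
  then show ?thesis by (simp only: ball_simps not_not)
qed

text \<open>The signature offers only the successor, so the order is obtained as its reflexive
  transitive closure, with a quantifier over sets closed under successor.\<close>

lemma mso_le: "mso (\<lambda>e E. e i \<le> e j)"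
proof -
  have *: "(m \<le> n) \<longleftrightarrow> (\<forall>X. m \<in> X \<and> (\<forall>k. k \<in> X \<longrightarrow> Suc k \<in> X) \<longrightarrow> n \<in> X)" for m n :: nat
  proof
    assume "m \<le> n"
    then show "\<forall>X. m \<in> X \<and> (\<forall>k. k \<in> X \<longrightarrow> Suc k \<in> X) \<longrightarrow> n \<in> X"
      by (induction rule: dec_induct) auto
  next
    assume "\<forall>X. m \<in> X \<and> (\<forall>k. k \<in> X \<longrightarrow> Suc k \<in> X) \<longrightarrow> n \<in> X"
    from this[rule_format, of "{m..}"] show "m \<le> n" by simp
  qed
  show ?thesis unfolding *
    by (intro mso_allS mso_imp mso_conj mso_allN mso_mem mso_Suc_mem)
qed

lemma mso_less: "mso (\<lambda>e E. e i < e j)"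
  using mso_not[OF mso_le[of j i]] by (simp add: not_le)

text \<open>A formula obtained from \<open>mso P\<close> may mention variables outside the tuple. By
  the invariance of P their values do not matter, so binding them existentially keeps the meaning
  and yields the conditions on free variables in \<open>definable\<close>. All number variables are
  bound in this way, hence the arbitrary value 0.\<close>

lemma definable_setsI:
  assumes "mso P" and inv: "\<And>e e' E E'. (\<And>i. i < L \<Longrightarrow> E i = E' i) \<Longrightarrow> P e E \<longleftrightarrow> P e' E'"
  shows "definable (replicate L SSet)
    {v \<in> tuples (replicate L SSet). P (\<lambda>_. 0) (\<lambda>i. the_set (v ! i))}"
proof -
  obtain \<phi> where \<phi>: "\<And>e E. sat e E \<phi> \<longleftrightarrow> P e E" using assms unfolding mso_def by blast
  have N: "free_nvars (foldr ExN xs \<psi>) = free_nvars \<psi> - set xs \<and>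
      free_svars (foldr ExN xs \<psi>) = free_svars \<psi>" for xs \<psi>
    by (induction xs) auto
  have S: "free_nvars (foldr ExS xs \<psi>) = free_nvars \<psi> \<and>
      free_svars (foldr ExS xs \<psi>) = free_svars \<psi> - set xs" for xs \<psi>
    by (induction xs) auto
  obtain xs where xs: "set xs = free_nvars \<phi>"
    using finite_list finite_free_vars by metis
  obtain ys where ys: "set ys = free_svars \<phi> - {..<L}"
    using finite_list finite_free_vars finite_Diff by metis
  have satN: "sat e E (foldr ExN zs \<phi>) \<longleftrightarrow> P e E" for zs e E
  proof (induction zs arbitrary: e)
    case (Cons z zs)
    then show ?case using inv[of E E] by auto
  qed (simp add: \<phi>)
  have satS: "set zs \<inter> {..<L} = {} \<Longrightarrow> sat e E (foldr ExS zs (foldr ExN xs \<phi>)) \<longleftrightarrow> P e E" for zs e E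
  proof (induction zs arbitrary: E)
    case (Cons z zs)
    have "P e (E(z := X)) \<longleftrightarrow> P e E" for X
      by (rule inv) (use Cons.prems in auto)
    with Cons show ?case by auto
  qed (simp add: satN)
  have eq: "sat e E (foldr ExS ys (foldr ExN xs \<phi>)) \<longleftrightarrow> P (\<lambda>_. 0) E" for e E
    using satS[of ys e E] ys inv[of E E e "\<lambda>_. 0"] by auto
  show ?thesis
    unfolding definable_def
    by (rule exI[of _ "foldr ExS ys (foldr ExN xs \<phi>)"]) (auto simp: S N xs ys eq)
qed

section \<open>Finite-valued functions and words that depend on the environment\<close>

definition mso_fun :: "((nat \<Rightarrow> nat) \<Rightarrow> (nat \<Rightarrow> nat set) \<Rightarrow> 'q) \<Rightarrow> bool" where
  "mso_fun f \<longleftrightarrow> (\<exists>Q. finite Q \<and> (\<forall>e E. f e E \<in> Q)) \<and> (\<forall>q. mso (\<lambda>e E. f e E = q))"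

text \<open>A can be any predicate: the range is finite, so the condition is a disjunction over the
  values that satisfy A. Integer computations on letters and states therefore enter formulas
  freely.\<close>

lemma mso_of_fun:
  assumes "mso_fun f"
  shows "mso (\<lambda>e E. A (f e E))"
proof -
  obtain Q where Q: "finite Q" "\<And>e E. f e E \<in> Q" using assms unfolding mso_fun_def by blast
  have "A (f e E) \<longleftrightarrow> (\<exists>q\<in>Q. A q \<and> f e E = q)" for e E using Q by auto
  moreover have "mso (\<lambda>e E. \<exists>q\<in>Q. A q \<and> f e E = q)"
    using assms unfolding mso_fun_def by (intro mso_bex_finite Q mso_conj mso_const) auto
  ultimately show ?thesis by simp
qed

lemma mso_fun_map2:
  assumes "mso_fun f" "mso_fun g"
  shows "mso_fun (\<lambda>e E. h (f e E) (g e E))"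
proof -
  obtain Q R where Q: "finite Q" "\<And>e E. f e E \<in> Q" and R: "finite R" "\<And>e E. g e E \<in> R"
    using assms unfolding mso_fun_def by blast
  have "mso (\<lambda>e E. h (f e E) (g e E) = q)" for q
  proof -
    have "h (f e E) (g e E) = q \<longleftrightarrow> (\<exists>x\<in>Q. f e E = x \<and> h x (g e E) = q)" for e E
      using Q by auto
    moreover have "mso (\<lambda>e E. \<exists>x\<in>Q. f e E = x \<and> h x (g e E) = q)"
      using assms(1) by (intro mso_bex_finite Q mso_conj mso_of_fun[OF assms(2)])
        (auto simp: mso_fun_def)
    ultimately show ?thesis by simp
  qed
  moreover have "finite (case_prod h ` (Q \<times> R))" using Q R by auto
  moreover have "h (f e E) (g e E) \<in> case_prod h ` (Q \<times> R)" for e E using Q R by auto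
  ultimately show ?thesis unfolding mso_fun_def by blast
qed

lemma mso_fun_map: "mso_fun f \<Longrightarrow> mso_fun (\<lambda>e E. h (f e E))"
  using mso_fun_map2[of f f "\<lambda>x _. h x"] by simp

lemma mso_fun_of_bool: "mso P \<Longrightarrow> mso_fun (\<lambda>e E. P e E)"
  unfolding mso_fun_def using mso_iff[OF _ mso_const]
  by (auto intro!: exI[of _ UNIV])

lemma mso_fun_rename:
  "mso_fun f \<Longrightarrow> mso_fun (\<lambda>e E. f (\<lambda>i. e (\<rho> i)) (\<lambda>i. E (\<sigma> i)))"
  unfolding mso_fun_def using mso_rename[of "\<lambda>e E. f e E = _" \<rho> \<sigma>] by blast

text \<open>A word may depend on the environment; its position is read from the number variable 0.\<close>

definition mso_word :: "((nat \<Rightarrow> nat) \<Rightarrow> (nat \<Rightarrow> nat set) \<Rightarrow> nat \<Rightarrow> 'q) \<Rightarrow> bool" where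
  "mso_word g \<longleftrightarrow> mso_fun (\<lambda>e E. g (\<lambda>i. e (Suc i)) E (e 0))"

lemma mso_fun_nth:
  assumes "mso_word g"
  shows "mso_fun (\<lambda>e E. g e E (e k))"
  using mso_fun_rename[OF assms[unfolded mso_word_def], of "case_nat k id" id] by simp

lemma mso_word_rename:
  assumes "mso_word g"
  shows "mso_word (\<lambda>e E. g (\<lambda>i. e (\<rho> i)) (\<lambda>i. E (\<sigma> i)))"
  using mso_fun_rename[OF assms[unfolded mso_word_def], of "case_nat 0 (\<lambda>i. Suc (\<rho> i))" \<sigma>]
  unfolding mso_word_def by simp

lemma mso_fun_nth_Suc:
  assumes "mso_word g"
  shows "mso_fun (\<lambda>e E. g e E (Suc (e k)))"
proof -
  obtain Q where Q: "finite Q" "\<And>e E n. g (\<lambda>i. e (Suc i)) E (e 0) \<in> Q"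
    using assms unfolding mso_fun_def mso_word_def by blast
  have "g e E n \<in> Q" for e E n using Q(2)[of "case_nat n e" E] by simp
  moreover have "mso (\<lambda>e E. g e E (Suc (e k)) = q)" for q
  proof -
    have "g e E (Suc (e k)) = q \<longleftrightarrow> (\<exists>m. m = Suc (e k) \<and> g e E m = q)" for e E by auto
    moreover have "mso (\<lambda>e E. \<exists>m. m = Suc (e k) \<and> g e E m = q)"
      using assms unfolding mso_word_def mso_fun_def by (intro mso_exN mso_conj mso_eq_Suc) blast
    ultimately show ?thesis by simp
  qed
  ultimately show ?thesis using Q unfolding mso_fun_def by blast
qed

lemma mso_eq_0: "mso (\<lambda>e E. e k = 0)"
proof -
  have "n = 0 \<longleftrightarrow> \<not> (\<exists>m. n = Suc m)" for n :: nat by (cases n) auto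
  moreover have "mso (\<lambda>e E. \<not> (\<exists>m. e k = Suc m))"
    by (intro mso_not mso_exN mso_eq_Suc)
  ultimately show ?thesis by simp
qed

lemma mso_fun_nth_0:
  assumes "mso_word g"
  shows "mso_fun (\<lambda>e E. g e E 0)"
proof -
  obtain Q where Q: "finite Q" "\<And>e E n. g (\<lambda>i. e (Suc i)) E (e 0) \<in> Q"
    using assms unfolding mso_fun_def mso_word_def by blast
  have "g e E n \<in> Q" for e E n using Q(2)[of "case_nat n e" E] by simp
  moreover have "mso (\<lambda>e E. g e E 0 = q)" for q
  proof -
    have "g e E 0 = q \<longleftrightarrow> (\<exists>m. m = 0 \<and> g e E m = q)" for e E by auto
    moreover have "mso (\<lambda>e E. \<exists>m. m = 0 \<and> g e E m = q)"
      using assms unfolding mso_word_def mso_fun_def by (intro mso_exN mso_conj mso_eq_0) blast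
    ultimately show ?thesis by simp
  qed
  ultimately show ?thesis using Q unfolding mso_fun_def by blast
qed

lemma mso_word_finite:
  assumes "mso_word g"
  obtains Q where "finite Q" "\<And>e E n. g e E n \<in> Q"
proof -
  obtain Q where Q: "finite Q" "\<And>e E n. g (\<lambda>i. e (Suc i)) E (e 0) \<in> Q"
    using assms unfolding mso_fun_def mso_word_def by blast
  have "g e E n \<in> Q" for e E n using Q(2)[of "case_nat n e" E] by simp
  with Q that show ?thesis by blast
qed

lemma mso_word_map: "mso_word f \<Longrightarrow> mso_word (\<lambda>e E n. h (f e E n))"
  unfolding mso_word_def by (rule mso_fun_map)

lemma mso_word_map2: "mso_word f \<Longrightarrow> mso_word g \<Longrightarrow> mso_word (\<lambda>e E n. h (f e E n) (g e E n))"
  unfolding mso_word_def by (rule mso_fun_map2)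

lemma mso_word_Suc: "mso_word f \<Longrightarrow> mso_word (\<lambda>e E n. f e E (Suc n))"
  using mso_fun_nth_Suc[OF mso_word_rename[of f Suc id], of 0] unfolding mso_word_def by simp

lemma mso_word_pred:
  assumes "mso_word f"
  shows "mso_word (\<lambda>e E n. case n of 0 \<Rightarrow> c | Suc m \<Rightarrow> f e E m)"
proof -
  obtain Q where Q: "finite Q" "\<And>e E n. f e E n \<in> Q" by (rule mso_word_finite[OF assms]) blast
  have "(case n of 0 \<Rightarrow> c | Suc m \<Rightarrow> f e E m) = q \<longleftrightarrow>
      n = 0 \<and> c = q \<or> (\<exists>m. n = Suc m \<and> f e E m = q)" for e E n q
    by (cases n) auto
  moreover have "mso (\<lambda>e E. e 0 = 0 \<and> c = q \<or>
      (\<exists>m. e 0 = Suc m \<and> f (\<lambda>i. e (Suc i)) E m = q))" for q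
    using mso_word_rename[OF assms, of Suc id] unfolding mso_word_def mso_fun_def
    by (intro mso_disj mso_conj mso_eq_0 mso_const mso_exN mso_eq_Suc) simp
  moreover have "(case n of 0 \<Rightarrow> c | Suc m \<Rightarrow> f e E m) \<in> insert c Q" for e E n
    using Q by (cases n) auto
  moreover have "finite (insert c Q)" using Q by simp
  ultimately show ?thesis unfolding mso_word_def mso_fun_def
    by (intro conjI exI[of _ "insert c Q"] allI) (assumption | simp only:)+
qed

text \<open>Column n of the L sets with indices from k on, so that L sets form one word over the
  subsets of \<open>{..<L}\<close>. The offset k locates a word inside a concatenation of
  tuples.\<close>

definition letter :: "nat \<Rightarrow> nat \<Rightarrow> (nat \<Rightarrow> nat set) \<Rightarrow> nat \<Rightarrow> nat set" where
  "letter L k E n = {c. c < L \<and> n \<in> E (k + c)}"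

lemma mso_word_letter: "mso_word (\<lambda>e. letter L k)"
proof -
  have "letter L k E n = S \<longleftrightarrow> S \<subseteq> {..<L} \<and> (\<forall>c\<in>{..<L}. n \<in> E (k + c) \<longleftrightarrow> c \<in> S)" for E n S
    unfolding letter_def by auto
  moreover have "mso (\<lambda>e E. S \<subseteq> {..<L} \<and> (\<forall>c\<in>{..<L}. e 0 \<in> E (k + c) \<longleftrightarrow> c \<in> S))" for S
    by (intro mso_conj mso_const mso_ball_finite mso_iff mso_mem) auto
  moreover have "letter L k E n \<in> Pow {..<L}" for E n unfolding letter_def by auto
  ultimately show ?thesis unfolding mso_word_def mso_fun_def
    by (auto intro!: exI[of _ "Pow {..<L}"])
qed

lemma mso_ex_family:
  assumes "mso P"
  shows "mso (\<lambda>e E. \<exists>F. P e (\<lambda>i. if i < L then F i else E (i - L)))"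
  using assms
proof (induction L arbitrary: P)
  case (Suc L)
  \<comment> \<open>The set bound by the extra quantifier sits at index 0 of the environment that
    the block shifts by L, hence at index L, directly after the block.\<close>
  have fam: "(\<lambda>i. if i < L then F i else case_nat X E (i - L)) =
      (\<lambda>i. if i < Suc L then (F(L := X)) i else E (i - Suc L))" for F X and E :: "nat \<Rightarrow> nat set"
  proof
    fix i
    have "i - L = Suc (i - Suc L)" if "i > L" using that by simp
    then show "(if i < L then F i else case_nat X E (i - L)) =
        (if i < Suc L then (F(L := X)) i else E (i - Suc L))"
      by (cases i L rule: linorder_cases) auto
  qed
  have eq: "(\<exists>F. P e (\<lambda>i. if i < Suc L then F i else E (i - Suc L))) \<longleftrightarrow>
      (\<exists>X F. P e (\<lambda>i. if i < L then F i else case_nat X E (i - L)))" for e E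
  proof
    assume "\<exists>F. P e (\<lambda>i. if i < Suc L then F i else E (i - Suc L))"
    then obtain F where "P e (\<lambda>i. if i < Suc L then F i else E (i - Suc L))" ..
    then have "P e (\<lambda>i. if i < L then F i else case_nat (F L) E (i - L))"
      by (simp only: fam[of F "F L" E] fun_upd_triv)
    then show "\<exists>X F. P e (\<lambda>i. if i < L then F i else case_nat X E (i - L))" by (intro exI)
  next
    assume "\<exists>X F. P e (\<lambda>i. if i < L then F i else case_nat X E (i - L))"
    then obtain X F where "P e (\<lambda>i. if i < L then F i else case_nat X E (i - L))" by (elim exE)
    then show "\<exists>F. P e (\<lambda>i. if i < Suc L then F i else E (i - Suc L))"
      by (intro exI) (simp only: fam[of F X E])
  qed
  have "case_nat (E 0) (\<lambda>i. E (Suc i)) = E" for E :: "nat \<Rightarrow> nat set"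
    by (auto simp: fun_eq_iff split: nat.splits)
  then have "mso (\<lambda>e E. \<exists>X F. P e (\<lambda>i. if i < L then F i else case_nat X E (i - L)))"
    using Suc.IH[OF Suc.prems] by (intro mso_exS) (simp only:)
  then show ?case by (simp only: eq)
qed simp

text \<open>A word over Q is coded by \<open>card Q\<close> sets: a position belongs to exactly the
  set numbered by its letter. The coding sets take the first L indices, which is why the premise
  reads the word from the environment and the parameters L places further on.\<close>

lemma mso_ex_word:
  fixes P :: "(nat \<Rightarrow> 'q) \<Rightarrow> (nat \<Rightarrow> nat) \<Rightarrow> (nat \<Rightarrow> nat set) \<Rightarrow> bool"
  assumes "finite Q"
    and *: "\<And>r L. mso_word (\<lambda>e. r) \<Longrightarrow> mso (\<lambda>e E. P (r E) e (\<lambda>i. E (i + L)))"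
  shows "mso (\<lambda>e E. \<exists>r. (\<forall>n. r n \<in> Q) \<and> P r e E)"
proof (cases "Q = {}")
  case True
  then show ?thesis by (simp add: mso_const)
next
  case False
  define L where "L = card Q"
  obtain h where h: "bij_betw h Q {0..<L}" using ex_bij_betw_finite_nat assms L_def by blast
  obtain q0 where q0: "q0 \<in> Q" using False by blast
  \<comment> \<open>Columns that are not singletons decode to a default letter, so every family of
    sets is a word over Q and the formula contains no well-formedness condition.\<close>
  define dec where "dec S = (if \<exists>q\<in>Q. S = {h q} then (THE q. q \<in> Q \<and> S = {h q}) else q0)" for S
  have dec: "dec {h q} = q" if "q \<in> Q" for q
  proof -
    have "(THE q'. q' \<in> Q \<and> {h q} = {h q'}) = q"
      using that h by (intro the_equality) (auto simp: bij_betw_def inj_on_def)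
    then show ?thesis unfolding dec_def using that by auto
  qed
  have decQ: "dec S \<in> Q" for S
  proof (cases "\<exists>q\<in>Q. S = {h q}")
    case True
    then show ?thesis using dec by auto
  next
    case False
    then show ?thesis unfolding dec_def using q0 by simp
  qed
  define r where "r E n = dec (letter L 0 E n)" for E n
  have "mso_word (\<lambda>e. r)" unfolding r_def by (rule mso_word_map[OF mso_word_letter])
  from mso_ex_family[OF *[OF this, of L], of L]
  have "mso (\<lambda>e E. \<exists>F. P (r (\<lambda>i. if i < L then F i else E (i - L))) e E)"
    by (simp only: add_diff_cancel_right' not_add_less2 if_False)
  moreover have "(\<exists>F. P (r (\<lambda>i. if i < L then F i else E (i - L))) e E) \<longleftrightarrow>
      (\<exists>r. (\<forall>n. r n \<in> Q) \<and> P r e E)" for e E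
  proof
    assume "\<exists>F. P (r (\<lambda>i. if i < L then F i else E (i - L))) e E"
    then obtain F where "P (r (\<lambda>i. if i < L then F i else E (i - L))) e E" by (elim exE)
    then show "\<exists>r. (\<forall>n. r n \<in> Q) \<and> P r e E"
      using decQ by (intro exI conjI) (auto simp: r_def)
  next
    assume "\<exists>r. (\<forall>n. r n \<in> Q) \<and> P r e E"
    then obtain s where s: "\<forall>n. s n \<in> Q" "P s e E" by (elim exE conjE)
    have "letter L 0 (\<lambda>i. if i < L then {n. h (s n) = i} else E (i - L)) n = {h (s n)}" for n
      unfolding letter_def using s(1) h by (auto simp: bij_betw_def)
    then have "r (\<lambda>i. if i < L then {n. h (s n) = i} else E (i - L)) = s"
      unfolding r_def using dec s(1) by auto
    with s(2) show "\<exists>F. P (r (\<lambda>i. if i < L then F i else E (i - L))) e E"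
      by (intro exI[of _ "\<lambda>i. {n. h (s n) = i}"]) (simp only:)
  qed
  ultimately show ?thesis by (simp only:)
qed

section \<open>Expansions in a quadratic unit base\<close>

text \<open>
  A word \<open>f\<close> stands for \<open>\<Sum>\<^sub>n fst (f n) \<beta>\<^sup>n + \<Sum>\<^sub>n snd (f n) \<beta>\<^bsup>-n\<^esup>\<close>. Position 0 occurs in both halves, so
  that conjugation of finite words exchanges the two halves; canonical words have \<open>snd (f 0) = 0\<close>.
\<close>

definition fin :: "(nat \<Rightarrow> int \<times> int) \<Rightarrow> bool" where
  "fin f \<longleftrightarrow> (\<exists>N. \<forall>n\<ge>N. fst (f n) = 0)"

definition bnd :: "(nat \<Rightarrow> int \<times> int) \<Rightarrow> bool" where
  "bnd f \<longleftrightarrow> (\<exists>B. \<forall>n. \<bar>fst (f n)\<bar> \<le> B \<and> \<bar>snd (f n)\<bar> \<le> B)"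

text \<open>There is no carry: the digits may leave the alphabet of the two words, but they stay
  bounded and the value is the corresponding combination of values.\<close>

definition comb :: "int \<Rightarrow> int \<Rightarrow> (nat \<Rightarrow> int \<times> int) \<Rightarrow> (nat \<Rightarrow> int \<times> int) \<Rightarrow> nat \<Rightarrow> int \<times> int" where
  "comb c d f g n = (c * fst (f n) + d * fst (g n), c * snd (f n) + d * snd (g n))"

definition flip :: "(nat \<Rightarrow> int \<times> int) \<Rightarrow> nat \<Rightarrow> int \<times> int" where
  "flip f n = (snd (f n), fst (f n))"

definition trunc :: "int \<Rightarrow> (nat \<Rightarrow> int \<times> int) \<Rightarrow> nat \<Rightarrow> int \<times> int" where
  "trunc n f j = (if int j < n then fst (f j) else 0, if - int j < n then snd (f j) else 0)"

text \<open>The conjunct \<open>n < 0\<close> puts position 0 into the first half only, where the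
  power would otherwise be counted twice.\<close>

definition unit_word :: "int \<Rightarrow> nat \<Rightarrow> int \<times> int" where
  "unit_word n j = (if int j = n then 1 else 0, if n < 0 \<and> - int j = n then 1 else 0)"

definition digit :: "(nat \<Rightarrow> int \<times> int) \<Rightarrow> int \<Rightarrow> int" where
  "digit f i = (if 0 \<le> i then fst (f (nat i)) else 0) + (if i \<le> 0 then snd (f (nat (- i))) else 0)"

text \<open>This is multiplication by \<beta>. Both digits stored at position 0 move to position 1,
  hence the summand \<open>snd (h 0)\<close> there; the digit at -1 arrives in the second half of
  position 0.\<close>

definition shift_up :: "(nat \<Rightarrow> int \<times> int) \<Rightarrow> nat \<Rightarrow> int \<times> int" where
  "shift_up h n = ((case n of 0 \<Rightarrow> 0 | Suc m \<Rightarrow> fst (h m) + (if m = 0 then snd (h 0) else 0)),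
     snd (h (Suc n)))"

lemma fin_comb: "fin f \<Longrightarrow> fin g \<Longrightarrow> fin (comb c d f g)"
  unfolding fin_def comb_def
  by (metis (no_types, lifting) fst_conv le_trans linorder_le_cases mult_zero_right add_0)

lemma bndI: "(\<And>n. \<bar>fst (f n)\<bar> \<le> B \<and> \<bar>snd (f n)\<bar> \<le> B) \<Longrightarrow> bnd f"
  unfolding bnd_def by blast

lemma bndE:
  assumes "bnd f"
  obtains B where "0 \<le> B" "\<And>n. \<bar>fst (f n)\<bar> \<le> B" "\<And>n. \<bar>snd (f n)\<bar> \<le> B"
proof -
  obtain B where "\<forall>n. \<bar>fst (f n)\<bar> \<le> B \<and> \<bar>snd (f n)\<bar> \<le> B" using assms unfolding bnd_def by blast
  moreover from this have "0 \<le> B" by (meson abs_ge_zero order_trans)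
  ultimately show thesis using that by blast
qed

lemma bnd_of_digits:
  assumes "\<And>n. h n \<in> {-C..C} \<times> {-C..C}"
  shows "bnd h"
proof (rule bndI)
  fix n
  show "\<bar>fst (h n)\<bar> \<le> C \<and> \<bar>snd (h n)\<bar> \<le> C" using assms[of n] by (auto simp: mem_Times_iff)
qed

lemma bnd_comb:
  assumes "bnd f" "bnd g"
  shows "bnd (comb c d f g)"
proof -
  obtain B B' where B: "0 \<le> B" "\<And>n. \<bar>fst (f n)\<bar> \<le> B" "\<And>n. \<bar>snd (f n)\<bar> \<le> B"
    and B': "0 \<le> B'" "\<And>n. \<bar>fst (g n)\<bar> \<le> B'" "\<And>n. \<bar>snd (g n)\<bar> \<le> B'"
    using assms by (metis bndE)
  have *: "\<bar>c * x + d * y\<bar> \<le> \<bar>c\<bar> * B + \<bar>d\<bar> * B'" if "\<bar>x\<bar> \<le> B" "\<bar>y\<bar> \<le> B'" for x y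
  proof -
    have "\<bar>c * x + d * y\<bar> \<le> \<bar>c\<bar> * \<bar>x\<bar> + \<bar>d\<bar> * \<bar>y\<bar>"
      using abs_triangle_ineq[of "c * x" "d * y"] by (simp add: abs_mult)
    also have "\<dots> \<le> \<bar>c\<bar> * B + \<bar>d\<bar> * B'" using that by (intro add_mono mult_left_mono) auto
    finally show ?thesis .
  qed
  show ?thesis by (rule bndI[of _ "\<bar>c\<bar> * B + \<bar>d\<bar> * B'"]) (simp add: comb_def * B B')
qed

lemma bnd_flip: "bnd f \<Longrightarrow> bnd (flip f)"
  unfolding bnd_def flip_def by auto

lemma fin_trunc: "fin f \<Longrightarrow> fin (trunc n f)"
  unfolding fin_def trunc_def by auto

lemma bnd_trunc:
  assumes "bnd f"
  shows "bnd (trunc n f)"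
proof -
  obtain B where "0 \<le> B" "\<And>n. \<bar>fst (f n)\<bar> \<le> B" "\<And>n. \<bar>snd (f n)\<bar> \<le> B"
    using assms bndE by blast
  then show ?thesis by (intro bndI[of _ B]) (simp add: trunc_def)
qed

lemma fin_unit: "fin (unit_word n)" "fin (flip (unit_word n))"
  unfolding fin_def unit_word_def flip_def by (auto intro!: exI[of _ "Suc (nat \<bar>n\<bar>)"])

lemma bnd_unit: "bnd (unit_word n)"
  by (rule bndI[of _ 1]) (simp add: unit_word_def)

lemma digit_trunc: "digit (trunc n f) i = (if i < n then digit f i else 0)"
  unfolding digit_def trunc_def by auto

lemma flip_comb: "flip (comb c d f g) = comb c d (flip f) (flip g)"
  unfolding flip_def comb_def by auto

text \<open>A quadratic unit of norm 1 and trace t; the other root is \<open>1 / \<beta>\<close>.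
  From t \<ge> 3 follows \<beta> > 2, so that division by \<beta> at least halves every bound. The
  value t = 2 would be the degenerate case \<beta> = 1.\<close>

locale unit_base =
  fixes t :: int and \<beta> :: real
  assumes t_ge_3: "3 \<le> t" and \<beta>_gt_1: "1 < \<beta>" and \<beta>_square: "\<beta>\<^sup>2 = t * \<beta> - 1"
begin

definition vl :: "(nat \<Rightarrow> int \<times> int) \<Rightarrow> real" where
  "vl f = (\<Sum>n. of_int (fst (f n)) * \<beta> ^ n) + (\<Sum>n. of_int (snd (f n)) / \<beta> ^ n)"

lemma \<beta>_pos: "0 < \<beta>" using \<beta>_gt_1 by simp

lemma inverse_\<beta>: "1 / \<beta> = t - \<beta>"
  using \<beta>_square \<beta>_pos by (simp add: field_simps power2_eq_square)

lemma \<beta>_gt_2: "2 < \<beta>"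
proof -
  have "1 / \<beta> < 1" using \<beta>_gt_1 by simp
  with inverse_\<beta> t_ge_3 show ?thesis by simp
qed

lemma \<beta>_less_t: "\<beta> < t"
proof -
  have "0 < 1 / \<beta>" using \<beta>_pos by simp
  with inverse_\<beta> show ?thesis by simp
qed

lemma summable_pos:
  assumes "fin f"
  shows "summable (\<lambda>n. of_int (fst (f n)) * \<beta> ^ n)"
proof -
  from assms obtain N where "\<forall>n\<ge>N. fst (f n) = 0" unfolding fin_def ..
  then have "of_int (fst (f n)) * \<beta> ^ n = 0" if "n \<notin> {..<N}" for n using that by simp
  then show ?thesis by (rule summable_finite[OF finite_lessThan])
qed

text \<open>Comparison with the geometric series; the factor 2 bounds
  \<open>1 / (1 - 1 / \<beta>)\<close> because \<beta> > 2.\<close>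

lemma bounded_series:
  fixes d :: "nat \<Rightarrow> int"
  assumes "\<And>n. \<bar>d n\<bar> \<le> B"
  shows "summable (\<lambda>n. d n / \<beta> ^ n)" "\<bar>\<Sum>n. d n / \<beta> ^ n\<bar> \<le> 2 * real_of_int B"
proof -
  have B: "0 \<le> B" using assms[of 0] by simp
  have s: "(\<lambda>n. B * (1 / \<beta>) ^ n) sums (B * (1 / (1 - 1 / \<beta>)))"
    using \<beta>_gt_1 by (intro sums_mult geometric_sums) simp
  have le: "norm (d n / \<beta> ^ n) \<le> B * (1 / \<beta>) ^ n" for n
    using assms[of n] \<beta>_pos by (simp add: field_simps abs_mult flip: of_int_abs)
  show "summable (\<lambda>n. d n / \<beta> ^ n)"
    by (rule summable_comparison_test'[OF sums_summable[OF s], of 0]) (use le in simp)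
  have "norm (\<Sum>n. d n / \<beta> ^ n) \<le> (\<Sum>n. real_of_int B * (1 / \<beta>) ^ n)"
    by (rule norm_suminf_le[OF le]) (rule sums_summable[OF s])
  also have "\<dots> = B * (1 / (1 - 1 / \<beta>))" using s by (rule sums_unique[symmetric])
  also have "\<dots> \<le> real_of_int B * 2"
  proof (rule mult_left_mono)
    have "1 / \<beta> \<le> 1 / 2" by (rule frac_le) (use \<beta>_gt_2 in simp_all)
    then have "1 / 2 \<le> 1 - 1 / \<beta>" by linarith
    then have "1 / (1 - 1 / \<beta>) \<le> 1 / (1 / 2)" by (intro frac_le zero_le_one order_refl) simp
    then show "1 / (1 - 1 / \<beta>) \<le> 2" by simp
  qed (use B in simp)
  finally show "\<bar>\<Sum>n. d n / \<beta> ^ n\<bar> \<le> 2 * real_of_int B" by simp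
qed

lemma summable_neg:
  assumes "bnd f"
  shows "summable (\<lambda>n. of_int (snd (f n)) / \<beta> ^ n)"
  using assms by (metis bndE bounded_series(1))

lemma vl_comb:
  assumes "fin f" "bnd f" "fin g" "bnd g"
  shows "vl (comb c d f g) = c * vl f + d * vl g"
proof -
  have "(\<Sum>n. of_int (fst (comb c d f g n)) * \<beta> ^ n) =
      (\<Sum>n. c * (of_int (fst (f n)) * \<beta> ^ n) + d * (of_int (fst (g n)) * \<beta> ^ n))"
    by (simp add: comb_def algebra_simps)
  also have "\<dots> = c * (\<Sum>n. of_int (fst (f n)) * \<beta> ^ n) + d * (\<Sum>n. of_int (fst (g n)) * \<beta> ^ n)"
    using assms by (simp add: suminf_add[symmetric] suminf_mult summable_pos summable_mult)
  finally have 1: "(\<Sum>n. of_int (fst (comb c d f g n)) * \<beta> ^ n) = \<dots>" .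
  have "(\<Sum>n. of_int (snd (comb c d f g n)) / \<beta> ^ n) =
      (\<Sum>n. c * (of_int (snd (f n)) / \<beta> ^ n) + d * (of_int (snd (g n)) / \<beta> ^ n))"
    by (simp add: comb_def algebra_simps add_divide_distrib)
  also have "\<dots> = (\<Sum>n. c * (of_int (snd (f n)) / \<beta> ^ n)) + (\<Sum>n. d * (of_int (snd (g n)) / \<beta> ^ n))"
    using assms by (intro suminf_add[symmetric] summable_mult summable_neg)
  also have "\<dots> = c * (\<Sum>n. of_int (snd (f n)) / \<beta> ^ n) + d * (\<Sum>n. of_int (snd (g n)) / \<beta> ^ n)"
    using assms by (simp only: suminf_mult summable_neg)
  finally show ?thesis unfolding vl_def 1 by (simp add: algebra_simps)
qed

section \<open>Runs of Horner states and the zero test\<close>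

text \<open>
  Horner states \<open>p + q \<beta>\<close> are stored as pairs \<open>(p, q)\<close>; \<open>rv\<close> and \<open>cv\<close> are the value and its conjugate.
  A run carries at index \<open>n\<close> the states at the positions \<open>n\<close> and \<open>-n\<close>.
\<close>

definition step :: "int \<times> int \<Rightarrow> int \<times> int" where
  "step s = (- snd s, fst s + t * snd s)"

definition plus_int :: "int \<times> int \<Rightarrow> int \<Rightarrow> int \<times> int" where
  "plus_int s c = (fst s + c, snd s)"

definition rv :: "int \<times> int \<Rightarrow> real" where
  "rv s = of_int (fst s) + of_int (snd s) * \<beta>"

definition cv :: "int \<times> int \<Rightarrow> real" where
  "cv s = of_int (fst s) + of_int (snd s) / \<beta>"

lemma rv_step: "rv (step s) = \<beta> * rv s"
proof -
  have "- S + (F + t * S) * \<beta> = \<beta> * (F + S * \<beta>)" for S F :: real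
    using \<beta>_square by algebra
  then show ?thesis by (simp add: rv_def step_def)
qed

lemma cv_step: "cv (step s) = cv s / \<beta>"
proof -
  have "- S + (F + t * S) * (t - \<beta>) = (F + S * (t - \<beta>)) * (t - \<beta>)" for S F :: real
    using \<beta>_square by algebra
  from this[of "of_int (snd s)" "of_int (fst s)", folded inverse_\<beta>] show ?thesis by (simp add: cv_def step_def)
qed

lemma rv_plus: "rv (plus_int s c) = rv s + c" and cv_plus: "cv (plus_int s c) = cv s + c"
  by (simp_all add: rv_def cv_def plus_int_def)

text \<open>Both halves are read towards smaller exponents. In the first half index n + 1 precedes
  n, and the start is fixed by the states being 0 from some point on; the second half continues at
  position 0 with the state reached there. All conditions are local or eventual, hence expressible,
  and a run forces \<open>fin g\<close>.\<close>

definition run :: "(nat \<Rightarrow> int \<times> int) \<Rightarrow> (nat \<Rightarrow> (int \<times> int) \<times> (int \<times> int)) \<Rightarrow> bool" where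
  "run g r \<longleftrightarrow> (\<exists>N. \<forall>n\<ge>N. fst (r n) = (0, 0) \<and> fst (g n) = 0) \<and>
     snd (r 0) = plus_int (fst (r 0)) (snd (g 0)) \<and>
     (\<forall>n. fst (r n) = plus_int (step (fst (r (Suc n)))) (fst (g n)) \<and>
          snd (r (Suc n)) = plus_int (step (snd (r n))) (snd (g (Suc n))))"

definition box :: "int \<Rightarrow> ((int \<times> int) \<times> (int \<times> int)) set" where
  "box C = ({-C..C} \<times> {-C..C}) \<times> ({-C..C} \<times> {-C..C})"

lemma run_pos: "run g r \<Longrightarrow> rv (fst (r 0)) = (\<Sum>i<n. of_int (fst (g i)) * \<beta> ^ i) + \<beta> ^ n * rv (fst (r n))"
proof (induction n)
  case (Suc n)
  have "fst (r n) = plus_int (step (fst (r (Suc n)))) (fst (g n))"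
    using Suc.prems unfolding run_def by blast
  then have "rv (fst (r n)) = \<beta> * rv (fst (r (Suc n))) + of_int (fst (g n))"
    by (simp add: rv_plus rv_step)
  with Suc show ?case by (simp add: algebra_simps)
qed simp

lemma run_neg:
  "run g r \<Longrightarrow> rv (snd (r n)) = \<beta> ^ n * (rv (fst (r 0)) + (\<Sum>i<Suc n. of_int (snd (g i)) / \<beta> ^ i))"
proof (induction n)
  case 0
  have "snd (r 0) = plus_int (fst (r 0)) (snd (g 0))" using 0 unfolding run_def by blast
  then show ?case by (simp add: rv_plus)
next
  case (Suc n)
  have "snd (r (Suc n)) = plus_int (step (snd (r n))) (snd (g (Suc n)))"
    using Suc.prems unfolding run_def by blast
  then have "rv (snd (r (Suc n))) = \<beta> * rv (snd (r n)) + of_int (snd (g (Suc n)))"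
    by (simp add: rv_plus rv_step)
  with Suc \<beta>_pos show ?case by (simp add: field_simps)
qed

lemma run_pos_sum:
  assumes "run g r"
  shows "rv (fst (r 0)) = (\<Sum>n. of_int (fst (g n)) * \<beta> ^ n)"
proof -
  obtain N where N: "\<forall>n\<ge>N. fst (r n) = (0, 0) \<and> fst (g n) = 0"
    using assms unfolding run_def by blast
  have "(\<Sum>n. of_int (fst (g n)) * \<beta> ^ n) = (\<Sum>n<N. of_int (fst (g n)) * \<beta> ^ n)"
    using N by (intro suminf_finite) auto
  moreover have "rv (fst (r N)) = 0" using N by (simp add: rv_def)
  ultimately show ?thesis using run_pos[OF assms, of N] by simp
qed

lemma tendsto_div_power: "(\<lambda>n. c / \<beta> ^ n) \<longlonglongrightarrow> 0"
  using LIMSEQ_realpow_zero[of "1 / \<beta>", THEN tendsto_mult_left, of c] \<beta>_gt_1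
  by (simp add: power_one_over)

text \<open>The state at position -n is \<open>\<beta> ^ n\<close> times the value of the digits
  down to that position. Bounded states thus make these partial values tend to 0, and their limit is
  \<open>vl g\<close>.\<close>

lemma vl_zero_of_run:
  assumes "run g r" "\<And>n. r n \<in> box C" "bnd g"
  shows "vl g = 0"
proof -
  let ?x = "rv (fst (r 0))"
  have "(\<lambda>n. ?x + (\<Sum>i<Suc n. of_int (snd (g i)) / \<beta> ^ i)) \<longlonglongrightarrow> ?x + (\<Sum>n. of_int (snd (g n)) / \<beta> ^ n)"
    using summable_LIMSEQ[OF summable_neg[OF assms(3)]]
    by (intro tendsto_add tendsto_const) (rule LIMSEQ_Suc)
  moreover have "(\<lambda>n. ?x + (\<Sum>i<Suc n. of_int (snd (g i)) / \<beta> ^ i)) \<longlonglongrightarrow> 0"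
  proof (rule Lim_null_comparison[OF _ tendsto_div_power])
    have "norm (?x + (\<Sum>i<Suc n. of_int (snd (g i)) / \<beta> ^ i)) \<le> (C + C * \<beta>) / \<beta> ^ n" for n
    proof -
      obtain p q where pq: "snd (r n) = (p, q)" by fastforce
      with assms(2)[of n] have "\<bar>p\<bar> \<le> C" "\<bar>q\<bar> \<le> C" by (auto simp: box_def mem_Times_iff)
      then have "\<bar>real_of_int p\<bar> \<le> C" "\<bar>real_of_int q\<bar> \<le> C" by linarith+
      then have "\<bar>real_of_int p\<bar> + \<bar>real_of_int q\<bar> * \<beta> \<le> C + C * \<beta>"
        using \<beta>_pos by (intro add_mono mult_right_mono) auto
      moreover have "\<bar>p + q * \<beta>\<bar> \<le> \<bar>real_of_int p\<bar> + \<bar>real_of_int q\<bar> * \<beta>"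
        using abs_triangle_ineq[of "real_of_int p" "q * \<beta>"] \<beta>_pos by (simp add: abs_mult)
      ultimately have "\<bar>rv (snd (r n))\<bar> \<le> C + C * \<beta>" by (simp add: rv_def pq)
      moreover have "?x + (\<Sum>i<Suc n. of_int (snd (g i)) / \<beta> ^ i) = rv (snd (r n)) / \<beta> ^ n"
        using run_neg[OF assms(1), of n] \<beta>_pos by simp
      ultimately show ?thesis using \<beta>_pos by (simp add: divide_right_mono)
    qed
    then show "\<forall>\<^sub>F n in sequentially.
        norm (?x + (\<Sum>i<Suc n. of_int (snd (g i)) / \<beta> ^ i)) \<le> (C + C * \<beta>) / \<beta> ^ n" by simp
  qed
  ultimately have "?x + (\<Sum>n. of_int (snd (g n)) / \<beta> ^ n) = 0" using LIMSEQ_unique by blast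
  then show ?thesis unfolding vl_def run_pos_sum[OF assms(1)] .
qed

text \<open>For s = (p, q), subtracting the conjugate leaves
  \<open>q * (\<beta> - 1 / \<beta>)\<close> with a factor of at least 1, so \<bar>q\<bar> \<le> 2
  M; the bound for p follows from \<open>rv s\<close> and \<beta> < t.\<close>

lemma pair_bound:
  assumes "\<bar>rv s\<bar> \<le> M" "\<bar>cv s\<bar> \<le> M"
  shows "s \<in> {- (M * (1 + 2 * t))..M * (1 + 2 * t)} \<times> {- (M * (1 + 2 * t))..M * (1 + 2 * t)}"
proof -
  obtain p q where s: "s = (p, q)" by fastforce
  have "1 \<le> \<beta> - 1 / \<beta>"
  proof -
    have "1 / \<beta> < 1" using \<beta>_gt_1 by simp
    then show ?thesis using \<beta>_gt_2 by linarith
  qed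
  then have "\<bar>real_of_int q\<bar> * 1 \<le> \<bar>real_of_int q\<bar> * (\<beta> - 1 / \<beta>)" by (intro mult_left_mono) auto
  also have "\<dots> = \<bar>q * (\<beta> - 1 / \<beta>)\<bar>"
    using \<open>1 \<le> \<beta> - 1 / \<beta>\<close> by (simp only: abs_mult abs_of_pos)
  also have "q * (\<beta> - 1 / \<beta>) = rv s - cv s" by (simp add: s rv_def cv_def algebra_simps)
  also have "\<bar>rv s - cv s\<bar> \<le> 2 * M" using assms by linarith
  finally have q: "\<bar>real_of_int q\<bar> \<le> 2 * M" by simp
  then have M: "0 \<le> M" by linarith
  have "\<bar>real_of_int p\<bar> \<le> \<bar>rv s\<bar> + \<bar>q * \<beta>\<bar>" by (simp add: s rv_def)
  also have "\<bar>q * \<beta>\<bar> \<le> 2 * M * t"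
    using q \<beta>_less_t \<beta>_pos by (auto simp: abs_mult intro!: mult_mono)
  finally have "\<bar>real_of_int p\<bar> \<le> M * (1 + 2 * t)" using assms by (simp add: algebra_simps)
  then have "real_of_int \<bar>p\<bar> \<le> real_of_int (M * (1 + 2 * t))" by simp
  then have p: "\<bar>p\<bar> \<le> M * (1 + 2 * t)" by (simp only: of_int_le_iff)
  have "\<bar>q\<bar> \<le> 2 * M" using q by linarith
  also have "\<dots> \<le> M * (1 + 2 * t)" using M t_ge_3 by (auto simp: mult.commute intro!: mult_left_mono)
  finally show ?thesis using p by (auto simp: s)
qed

text \<open>Conjugates of states are bounded for every word with bounded digits, since each step
  divides them by \<beta>. Real values could grow, but total value 0 makes a state minus the scaled
  value of the digits still to be read. In the second half this is a geometric tail; in the first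
  half the bound is carried upwards from position 0. The largest bound that occurs is 3 B.\<close>

lemma run_of_vl_zero:
  assumes "fin g" and B: "\<And>n. \<bar>fst (g n)\<bar> \<le> B" "\<And>n. \<bar>snd (g n)\<bar> \<le> B" and "vl g = 0"
  shows "\<exists>r. (\<forall>n. r n \<in> box (3 * B * (1 + 2 * t))) \<and> run g r"
proof -
  have B0: "0 \<le> B" using B(1)[of 0] by simp
  have Br: "\<bar>real_of_int (fst (g n))\<bar> \<le> B" "\<bar>real_of_int (snd (g n))\<bar> \<le> B" for n
    using B[of n] by linarith+
  obtain N where N: "\<forall>n\<ge>N. fst (g n) = 0" using assms(1) unfolding fin_def by blast
  \<comment> \<open>\<open>s k\<close> is the state at position \<open>N - k\<close>, computed from
    the top. In \<sigma> the truncated subtraction supplies the zero state at all positions from N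
    on.\<close>
  define s where "s = rec_nat (0, 0) (\<lambda>k x. plus_int (step x) (fst (g (N - Suc k))))"
  have s_simps: "s 0 = (0, 0)" "s (Suc k) = plus_int (step (s k)) (fst (g (N - Suc k)))" for k
    by (simp_all add: s_def)
  define \<sigma> where "\<sigma> n = s (N - n)" for n
  have \<sigma>: "\<sigma> n = plus_int (step (\<sigma> (Suc n))) (fst (g n))" for n
  proof (cases "n < N")
    case True
    then obtain k where "N = n + Suc k" using less_imp_Suc_add by auto
    then have "N - n = Suc k" "N - Suc n = k" "N - Suc k = n" by auto
    then show ?thesis unfolding \<sigma>_def by (simp only: s_simps)
  next
    case False
    then show ?thesis unfolding \<sigma>_def using N by (simp add: s_simps step_def plus_int_def)
  qed
  define \<tau> where "\<tau> = rec_nat (plus_int (\<sigma> 0) (snd (g 0))) (\<lambda>k x. plus_int (step x) (snd (g (Suc k))))"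
  have \<tau>: "\<tau> 0 = plus_int (\<sigma> 0) (snd (g 0))" "\<tau> (Suc k) = plus_int (step (\<tau> k)) (snd (g (Suc k)))" for k
    by (simp_all add: \<tau>_def)
  define r where "r n = (\<sigma> n, \<tau> n)" for n
  have "run g r" unfolding run_def
  proof (intro conjI allI)
    show "\<exists>N. \<forall>n\<ge>N. fst (r n) = (0, 0) \<and> fst (g n) = 0"
      by (rule exI[of _ N]) (use N in \<open>simp add: r_def \<sigma>_def s_simps\<close>)
    show "fst (r n) = plus_int (step (fst (r (Suc n)))) (fst (g n))" for n
      using \<sigma>[of n] by (simp add: r_def)
  qed (simp_all add: r_def \<tau>)
  have half: "\<bar>x / \<beta>\<bar> \<le> c / 2" if "\<bar>x\<bar> \<le> c" for x c :: real
  proof -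
    have "\<bar>x\<bar> / \<beta> \<le> \<bar>x\<bar> / 2" by (rule frac_le) (use \<beta>_gt_2 in simp_all)
    then show ?thesis using that \<beta>_pos by simp
  qed
  \<comment> \<open>2 B is the fixed point of \<open>c / 2 + B\<close>, the effect of one step on a
    bound c.\<close>
  have cs: "\<bar>cv (s k)\<bar> \<le> 2 * B" for k
  proof (induction k)
    case (Suc k)
    have "\<bar>cv (s k) / \<beta> + of_int (fst (g (N - Suc k)))\<bar> \<le> 2 * real_of_int B / 2 + B"
      using half[OF Suc] Br(1)[of "N - Suc k"] by linarith
    then show ?case by (simp add: s_simps cv_plus cv_step)
  qed (simp add: s_simps cv_def B0)
  \<comment> \<open>The second half starts from at most 2 B + B, and 3 B is preserved because 3 B /
    2 + B \<le> 3 B.\<close>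
  have ct: "\<bar>cv (\<tau> k)\<bar> \<le> 3 * B" for k
  proof (induction k)
    case 0
    then show ?case using cs[of N] Br(2)[of 0] by (simp add: \<tau> cv_plus \<sigma>_def)
  next
    case (Suc k)
    have "\<bar>cv (\<tau> k) / \<beta> + of_int (snd (g (Suc k)))\<bar> \<le> 3 * real_of_int B / 2 + B"
      using half[OF Suc] Br(2)[of "Suc k"] by linarith
    then show ?case using B0 by (simp add: \<tau> cv_plus cv_step)
  qed
  have eq: "rv (\<sigma> 0) = - (\<Sum>n. of_int (snd (g n)) / \<beta> ^ n)"
    using run_pos_sum[OF \<open>run g r\<close>] assms(4) by (simp add: r_def vl_def)
  have rs: "\<bar>rv (\<sigma> n)\<bar> \<le> 2 * B" for n
  proof (induction n)
    case 0
    then show ?case using bounded_series(2)[of "\<lambda>n. snd (g n)", OF B(2)] by (simp add: eq)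
  next
    case (Suc n)
    have "rv (\<sigma> (Suc n)) = (rv (\<sigma> n) - of_int (fst (g n))) / \<beta>"
      using arg_cong[OF \<sigma>[of n], of rv] \<beta>_pos by (simp add: rv_plus rv_step)
    moreover have "\<bar>rv (\<sigma> n) - of_int (fst (g n))\<bar> \<le> 3 * B" using Suc Br(1)[of n] by linarith
    then have "\<bar>(rv (\<sigma> n) - of_int (fst (g n))) / \<beta>\<bar> \<le> 3 * real_of_int B / 2"
      by (intro half) simp
    moreover have "0 \<le> real_of_int B" using B0 by simp
    ultimately show ?case by linarith
  qed
  have rt: "\<bar>rv (\<tau> n)\<bar> \<le> 2 * B" for n
  proof -
    have sm: "summable (\<lambda>n. of_int (snd (g n)) / \<beta> ^ n)"
      by (rule bounded_series(1)[OF B(2)])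
    have "(\<Sum>n. of_int (snd (g n)) / \<beta> ^ n) =
        (\<Sum>i. of_int (snd (g (i + Suc n))) / \<beta> ^ (i + Suc n)) + (\<Sum>i<Suc n. of_int (snd (g i)) / \<beta> ^ i)"
      by (rule suminf_split_initial_segment[OF sm])
    then have "rv (\<tau> n) = - (\<beta> ^ n * (\<Sum>i. of_int (snd (g (i + Suc n))) / \<beta> ^ (i + Suc n)))"
      using run_neg[OF \<open>run g r\<close>, of n] by (simp add: r_def eq)
    also have "(\<Sum>i. of_int (snd (g (i + Suc n))) / \<beta> ^ (i + Suc n)) =
        (\<Sum>i. of_int (snd (g (i + Suc n))) / \<beta> ^ i / \<beta> ^ Suc n)"
      by (simp only: power_add divide_divide_eq_left)
    also have "\<dots> = (\<Sum>i. of_int (snd (g (i + Suc n))) / \<beta> ^ i) / \<beta> ^ Suc n"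
      by (rule suminf_divide) (rule bounded_series(1)[OF B(2)])
    finally have "rv (\<tau> n) = - (\<Sum>i. of_int (snd (g (i + Suc n))) / \<beta> ^ i) / \<beta>"
      using \<beta>_pos by simp
    moreover have "\<bar>\<Sum>i. of_int (snd (g (i + Suc n))) / \<beta> ^ i\<bar> \<le> 2 * real_of_int B"
      by (rule bounded_series(2)) (rule B(2))
    ultimately show ?thesis
      using half[of "- (\<Sum>i. of_int (snd (g (i + Suc n))) / \<beta> ^ i)" "2 * B"] B0 by simp
  qed
  have "r n \<in> box (3 * B * (1 + 2 * t))" for n
  proof -
    have "\<sigma> n \<in> {- (3 * B * (1 + 2 * t))..3 * B * (1 + 2 * t)} \<times> {- (3 * B * (1 + 2 * t))..3 * B * (1 + 2 * t)}"
      by (rule pair_bound) (use rs[of n] cs[of "N - n"] B0 in \<open>simp_all add: \<sigma>_def\<close>)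
    moreover have "\<tau> n \<in> {- (3 * B * (1 + 2 * t))..3 * B * (1 + 2 * t)} \<times> {- (3 * B * (1 + 2 * t))..3 * B * (1 + 2 * t)}"
      by (rule pair_bound) (use rt[of n] ct[of n] B0 in simp_all)
    ultimately show ?thesis unfolding box_def r_def by (rule SigmaI)
  qed
  with \<open>run g r\<close> show ?thesis by blast
qed

end

section \<open>Two-sided digit sums, truncation and canonical words\<close>

lemma sum_telescope_int:
  fixes z :: "int \<Rightarrow> real"
  assumes "a \<le> b"
  shows "(\<Sum>i\<in>{a..<b}. z (i + 1) - z i) = z b - z a"
  using assms
proof (induction b rule: int_ge_induct)
  case (step b)
  have "{a..<b + 1} = insert b {a..<b}" using step.hyps by auto
  then show ?case using step.IH by simp
qed simp

lemma fin_mset: "fin (\<lambda>n. (int (count M (int n)), if n = 0 then 0 else int (count M (- int n))))"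
  "fin (flip (\<lambda>n. (int (count M (int n)), if n = 0 then 0 else int (count M (- int n)))))"
proof -
  obtain N where N: "abs ` set_mset M \<subseteq> {..N}"
    using finite_set_mset[of M] by (meson finite_imageI bounded_nat_set_is_finite finite_int_iff_bounded_le)
  have "count M i = 0" if "\<bar>i\<bar> > N" for i
    using N that by (auto simp: count_eq_zero_iff)
  then have "count M (int n) = 0" "count M (- int n) = 0" if "n \<ge> nat (N + 1)" for n
    using that by auto
  then show "fin (\<lambda>n. (int (count M (int n)), if n = 0 then 0 else int (count M (- int n))))"
    "fin (flip (\<lambda>n. (int (count M (int n)), if n = 0 then 0 else int (count M (- int n)))))"
    unfolding fin_def flip_def by (auto intro!: exI[of _ "nat (N + 1)"])
qed

context unit_base
begin

text \<open>This links the two half-series to one sum over integer positions. Position 0 lies in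
  both halves; \<open>0 < M\<close> keeps it in the range, so its merged digit is counted from K = 0
  on.\<close>

lemma digit_sum_tendsto:
  assumes "\<forall>n\<ge>N. fst (f n) = 0" "bnd f" "N \<le> M" "0 < M"
  shows "(\<lambda>K. \<Sum>i\<in>{- int K..<int M}. digit f i * \<beta> powi i) \<longlonglongrightarrow> vl f"
proof -
  have eq: "(\<Sum>i\<in>{- int K..<int M}. digit f i * \<beta> powi i) =
      (\<Sum>n<M. of_int (fst (f n)) * \<beta> ^ n) + (\<Sum>n<Suc K. of_int (snd (f n)) / \<beta> ^ n)" for K
  proof (induction K)
    case 0
    show ?case using \<open>0 < M\<close>
    proof (induction M)
      case (Suc M)
      show ?case
      proof (cases "M = 0")
        case True
        moreover have "{0..<1::int} = {0}" by auto
        ultimately show ?thesis by (simp add: digit_def)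
      next
        case False
        have "{- int 0..<int (Suc M)} = insert (int M) {- int 0..<int M}" by auto
        moreover have "digit f (int M) = fst (f M)" using False by (simp add: digit_def)
        ultimately show ?thesis using Suc False by (simp add: power_int_def)
      qed
    qed simp
  next
    case (Suc K)
    have "{- int (Suc K)..<int M} = insert (- int (Suc K)) {- int K..<int M}" by auto
    moreover have "digit f (- int (Suc K)) * \<beta> powi (- int (Suc K)) = of_int (snd (f (Suc K))) / \<beta> ^ Suc K"
    proof -
      have "\<not> 0 \<le> - int (Suc K)" "- int (Suc K) \<le> 0" by simp_all
      then have "digit f (- int (Suc K)) = snd (f (Suc K))"
        by (simp only: digit_def minus_minus nat_int if_True if_False add_0)
      then show ?thesis by (simp only: power_int_minus power_int_of_nat divide_inverse)
    qed
    moreover have "- int (Suc K) \<notin> {- int K..<int M}" by simp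
    ultimately show ?case using Suc by (simp only: sum.insert finite_atLeastLessThan_int sum.lessThan_Suc) simp
  qed
  have "(\<Sum>n<M. of_int (fst (f n)) * \<beta> ^ n) = (\<Sum>n. of_int (fst (f n)) * \<beta> ^ n)"
    using assms by (intro suminf_finite[symmetric]) auto
  then show ?thesis unfolding eq vl_def
    using summable_LIMSEQ[OF summable_neg[OF assms(2)], THEN LIMSEQ_Suc]
    by (intro tendsto_add) auto
qed

lemma vl_unit: "vl (unit_word n) = \<beta> powi n" and vl_flip_unit: "vl (flip (unit_word n)) = \<beta> powi (- n)"
proof -
  have 1: "(\<Sum>j. of_int (if int j = n then 1 else 0) * c j) = (if 0 \<le> n then c (nat n) else 0)" for c :: "nat \<Rightarrow> real"
  proof -
    have "(\<Sum>j. of_int (if int j = n then 1 else 0) * c j) =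
        (\<Sum>j\<in>{nat n}. of_int (if int j = n then 1 else 0) * c j)"
      by (rule suminf_finite) auto
    then show ?thesis by simp
  qed
  have 2: "(\<Sum>j. of_int (if n < 0 \<and> - int j = n then 1 else 0) * c j) =
      (if n < 0 then c (nat (- n)) else 0)" for c :: "nat \<Rightarrow> real"
  proof -
    have "(\<Sum>j. of_int (if n < 0 \<and> - int j = n then 1 else 0) * c j) =
        (\<Sum>j\<in>{nat (- n)}. of_int (if n < 0 \<and> - int j = n then 1 else 0) * c j)"
      by (rule suminf_finite) auto
    then show ?thesis by simp
  qed
  show "vl (unit_word n) = \<beta> powi n"
    unfolding vl_def unit_word_def fst_conv snd_conv divide_inverse 1 2
    by (auto simp: power_int_def power_inverse)
  show "vl (flip (unit_word n)) = \<beta> powi (- n)"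
    unfolding vl_def flip_def unit_word_def fst_conv snd_conv divide_inverse 1 2
    by (auto simp: power_int_def power_inverse)
qed

lemma vl_trunc_Suc:
  assumes "fin f" "bnd f"
  shows "vl (trunc (n + 1) f) = vl (trunc n f) + digit f n * \<beta> powi n"
proof -
  obtain N where N: "\<forall>n\<ge>N. fst (f n) = 0" using assms unfolding fin_def by blast
  define M where "M = max (Suc N) (nat (n + 2))"
  have M: "N \<le> M" "0 < M" "n < int M" by (auto simp: M_def)
  have lim: "(\<lambda>K. \<Sum>i\<in>{- int K..<int M}. (if i < m then digit f i else 0) * \<beta> powi i) \<longlonglongrightarrow> vl (trunc m f)" for m
    using digit_sum_tendsto[of N "trunc m f" M] N M bnd_trunc[OF assms(2)]
    unfolding digit_trunc by (simp add: trunc_def)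
  have "(\<Sum>i\<in>{- int K..<int M}. (if i < n + 1 then digit f i else 0) * \<beta> powi i) =
      (\<Sum>i\<in>{- int K..<int M}. (if i < n then digit f i else 0) * \<beta> powi i) + digit f n * \<beta> powi n"
    if "K \<ge> nat (- n)" for K
  proof -
    have "(\<Sum>i\<in>{- int K..<int M}. (if i < n + 1 then digit f i else 0) * \<beta> powi i) =
      (\<Sum>i\<in>{- int K..<int M}. (if i < n then digit f i else 0) * \<beta> powi i +
        (if i = n then digit f i * \<beta> powi i else 0))"
      by (rule sum.cong) auto
    also have "\<dots> = (\<Sum>i\<in>{- int K..<int M}. (if i < n then digit f i else 0) * \<beta> powi i) +
        digit f n * \<beta> powi n"
      using M that by (subst sum.distrib) (simp add: sum.delta)
    finally show ?thesis .
  qed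
  then have "\<forall>\<^sub>F K in sequentially.
      (\<Sum>i\<in>{- int K..<int M}. (if i < n then digit f i else 0) * \<beta> powi i) + digit f n * \<beta> powi n =
      (\<Sum>i\<in>{- int K..<int M}. (if i < n + 1 then digit f i else 0) * \<beta> powi i)"
    by (intro eventually_sequentiallyI[of "nat (- n)"]) (rule sym)
  then have "(\<lambda>K. \<Sum>i\<in>{- int K..<int M}. (if i < n + 1 then digit f i else 0) * \<beta> powi i)
      \<longlonglongrightarrow> vl (trunc n f) + digit f n * \<beta> powi n"
    by (rule Lim_transform_eventually[OF tendsto_add[OF lim[of n] tendsto_const]])
  with lim[of "n + 1"] show ?thesis by (rule LIMSEQ_unique)
qed

lemma trunc_large:
  assumes "\<forall>n\<ge>N. fst (f n) = 0" "int N < n"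
  shows "trunc n f = f"
proof
  fix j
  have "fst (f j) = 0" if "\<not> int j < n" using that assms by auto
  then show "trunc n f j = f j" using assms(2) by (auto simp: trunc_def prod_eq_iff)
qed

text \<open>The truncations of a canonical word below \<open>\<beta>\<^sup>n\<close> lie in \<open>[-\<beta>\<^sup>n / 2, \<beta>\<^sup>n / 2)\<close>.\<close>

definition canonical :: "(nat \<Rightarrow> int \<times> int) \<Rightarrow> bool" where
  "canonical f \<longleftrightarrow> fin f \<and> snd (f 0) = 0 \<and>
     (\<forall>n::int. 0 \<le> vl (comb 2 1 (trunc n f) (unit_word n)) \<and>
        \<not> 0 \<le> vl (comb 2 (- 1) (trunc n f) (unit_word n)))"

lemma canonical_bound:
  assumes "canonical f" "bnd f"
  shows "- (\<beta> powi n) \<le> 2 * vl (trunc n f)" "2 * vl (trunc n f) < \<beta> powi n"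
proof -
  have f: "fin f" "0 \<le> vl (comb 2 1 (trunc n f) (unit_word n))"
        "\<not> 0 \<le> vl (comb 2 (- 1) (trunc n f) (unit_word n))"
    using assms(1) by (simp_all add: canonical_def)
  have "vl (comb 2 d (trunc n f) (unit_word n)) = 2 * vl (trunc n f) + d * \<beta> powi n" for d
    using vl_comb[OF fin_trunc[OF f(1)] bnd_trunc[OF assms(2)] fin_unit(1) bnd_unit, of 2 d n n]
    by (simp add: vl_unit)
  with f show "- (\<beta> powi n) \<le> 2 * vl (trunc n f)" "2 * vl (trunc n f) < \<beta> powi n" by simp_all
qed

text \<open>Digits are compared from the top. If the truncations below m + 1 have equal values, then
  the difference of the digits at m, times \<open>\<beta> powi m\<close>, is a difference of two
  points of a half-open interval of length \<open>\<beta> powi m\<close>. This integer is therefore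
  0, and the truncations below m have equal values too.\<close>

lemma canonical_unique:
  assumes f: "canonical f" "bnd f" and g: "canonical g" "bnd g" and "vl f = vl g"
  shows "f = g"
proof -
  have fin: "fin f" "fin g" using f g by (simp_all add: canonical_def)
  obtain N where N: "\<forall>n\<ge>N. fst (f n) = 0" using fin unfolding fin_def by blast
  obtain N' where N': "\<forall>n\<ge>N'. fst (g n) = 0" using fin unfolding fin_def by blast
  define M where "M = int (Suc (max N N'))"
  have down: "(\<forall>i\<ge>n. digit f i = digit g i) \<and> vl (trunc n f) = vl (trunc n g)" if "n \<le> M" for n
    using that
  proof (induction n rule: int_le_induct)
    case base
    have "digit f i = digit g i" if "i \<ge> M" for i
    proof -
      have "nat i \<ge> N" "nat i \<ge> N'" "i > 0" using that by (auto simp: M_def)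
      then show ?thesis using N N' by (simp add: digit_def)
    qed
    moreover have "trunc M f = f" "trunc M g = g"
      by (rule trunc_large[OF N], simp add: M_def) (rule trunc_large[OF N'], simp add: M_def)
    ultimately show ?case using assms(5) by simp
  next
    case (step n)
    define m where "m = n - 1"
    have "vl (trunc n f) = vl (trunc m f) + digit f m * \<beta> powi m"
      "vl (trunc n g) = vl (trunc m g) + digit g m * \<beta> powi m"
      using vl_trunc_Suc[OF fin(1) f(2), of m] vl_trunc_Suc[OF fin(2) g(2), of m] by (simp_all add: m_def)
    with step have eq: "of_int (digit f m - digit g m) * \<beta> powi m = vl (trunc m g) - vl (trunc m f)"
      by (simp add: algebra_simps)
    have pos: "0 < \<beta> powi m" using \<beta>_pos by simp
    have "\<bar>vl (trunc m g) - vl (trunc m f)\<bar> < \<beta> powi m"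
      using canonical_bound[OF f, of m] canonical_bound[OF g, of m] by linarith
    then have "\<bar>real_of_int (digit f m - digit g m)\<bar> * \<beta> powi m < 1 * \<beta> powi m"
      using pos by (simp add: eq[symmetric] abs_mult)
    then have "\<bar>real_of_int (digit f m - digit g m)\<bar> < 1" using pos by (simp only: mult_less_cancel_right_pos)
    then have d: "digit f m = digit g m" by linarith
    with eq have "vl (trunc m f) = vl (trunc m g)" by simp
    moreover have "digit f i = digit g i" if "i \<ge> m" for i
      using d step that by (cases "i = m") (auto simp: m_def)
    ultimately show ?case by (simp add: m_def)
  qed
  have dig: "digit f i = digit g i" for i
    using down[of "min i M"] by simp
  show ?thesis
  proof
    fix j
    have "snd (f 0) = 0" "snd (g 0) = 0" using f g by (simp_all add: canonical_def)
    then show "f j = g j" using dig[of "int j"] dig[of "- int j"]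
      by (cases "j = 0") (auto simp: digit_def prod_eq_iff)
  qed
qed

text \<open>The map y \<mapsto> \<beta> y - \<lfloor>\<beta> y + c\<rfloor> is iterated on the
  interval [-c, 1 - c). The parameter serves two purposes: c = 1/2 rounds to the nearest and yields
  canonical words, c = 0 is the greedy expansion, whose nonnegative digits are used for the
  order.\<close>

lemma expansion:
  assumes c: "0 \<le> c" "c < 1" and x: "0 \<le> x / \<beta> ^ N + c" "x / \<beta> ^ N + c < 1"
  shows "\<exists>f. fin f \<and> snd (f 0) = 0 \<and> vl f = x \<and>
    (\<forall>n. f n \<in> {-t..t} \<times> {-t..t}) \<and> (c = 0 \<longrightarrow> (\<forall>n. f n \<in> {0..t} \<times> {0..t})) \<and>
    (\<forall>n. 0 \<le> vl (trunc n f) / \<beta> powi n + c \<and> vl (trunc n f) / \<beta> powi n + c < 1)"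
proof -
  define y where "y = rec_nat (x / \<beta> ^ N) (\<lambda>_ u. \<beta> * u - \<lfloor>\<beta> * u + c\<rfloor>)"
  have y: "y 0 = x / \<beta> ^ N" "y (Suc k) = \<beta> * y k - \<lfloor>\<beta> * y k + c\<rfloor>" for k
    by (simp_all add: y_def)
  have yb: "0 \<le> y k + c \<and> y k + c < 1" for k
    by (induction k) (use x in \<open>simp_all add: y, linarith+\<close>)
  \<comment> \<open>Iteration k, counted from 0, yields the digit at position
    \<open>N - 1 - k\<close>; from position N on the word is 0.\<close>
  define D where "D i = (if i \<ge> int N then 0 else \<lfloor>\<beta> * y (nat (int N - i - 1)) + c\<rfloor>)" for i
  \<comment> \<open>\<open>z i\<close> is the remainder to be represented by the digits below
    position i. Each digit contribution is a difference of successive remainders, so truncated sums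
    telescope.\<close>
  define z where "z i = (if i \<ge> int N then x else y (nat (int N - i)) * \<beta> powi i)" for i
  have zD: "D i * \<beta> powi i = z (i + 1) - z i" for i
  proof (cases "i \<ge> int N")
    case False
    define k where "k = nat (int N - i - 1)"
    have k: "nat (int N - i) = Suc k" using False by (simp add: k_def)
    have p: "\<beta> powi (i + 1) = \<beta> * \<beta> powi i" using \<beta>_pos by (simp add: power_int_add)
    have "z (i + 1) = y k * (\<beta> * \<beta> powi i)"
    proof (cases "i + 1 = int N")
      case True
      then have "k = 0" by (simp add: k_def)
      moreover have "\<beta> * \<beta> powi i = \<beta> ^ N" using True p by (metis power_int_of_nat)
      ultimately show ?thesis using True \<beta>_pos by (simp add: z_def y)
    next
      case 2: False
      then have "k = nat (int N - (i + 1))" by (simp add: k_def)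
      with 2 False p show ?thesis by (simp add: z_def)
    qed
    moreover have "z i = y (Suc k) * \<beta> powi i" using False by (simp add: z_def k)
    moreover have "D i = \<lfloor>\<beta> * y k + c\<rfloor>" using False by (simp add: D_def k_def)
    ultimately show ?thesis by (simp add: y algebra_simps)
  qed (simp add: D_def z_def)
  have Db: "- t \<le> D i \<and> D i \<le> t \<and> (c = 0 \<longrightarrow> 0 \<le> D i)" for i
  proof (cases "i \<ge> int N")
    case False
    define u where "u = y (nat (int N - i - 1))"
    have u: "- c \<le> u" "u < 1 - c" using yb[of "nat (int N - i - 1)"] by (simp_all add: u_def)
    have "\<beta> * - c \<le> \<beta> * u" "\<beta> * u < \<beta> * (1 - c)"
      using mult_left_mono[OF u(1), of \<beta>] mult_strict_left_mono[OF u(2), of \<beta>] \<beta>_pos by simp_all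
    moreover have "\<beta> * c \<le> \<beta> * 1" "1 * c \<le> \<beta> * c" using c \<beta>_gt_1 by (intro mult_left_mono mult_right_mono; simp)+
    ultimately have "- \<beta> \<le> \<beta> * u + c" "\<beta> * u + c < \<beta>"
      using c(1) by (simp_all only: mult_minus_right right_diff_distrib mult_1 mult_1_right)
    moreover have "c = 0 \<longrightarrow> 0 \<le> \<beta> * u + c" using u \<beta>_pos by auto
    ultimately have "- t \<le> \<lfloor>\<beta> * u + c\<rfloor>" "\<lfloor>\<beta> * u + c\<rfloor> \<le> t" "c = 0 \<Longrightarrow> 0 \<le> \<lfloor>\<beta> * u + c\<rfloor>"
      using \<beta>_less_t by (simp_all add: le_floor_iff floor_le_iff)
    then show ?thesis using False by (simp add: D_def u_def)
  qed (use t_ge_3 in \<open>simp add: D_def\<close>)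
  define f where "f j = (D (int j), if j = 0 then 0 else D (- int j))" for j
  have N: "\<forall>n\<ge>N. fst (f n) = 0" by (simp add: f_def D_def)
  have dig: "digit f i = D i" for i by (auto simp: f_def digit_def)
  have bf: "bnd f" by (rule bndI[of _ t]) (use Db t_ge_3 in \<open>auto simp: f_def abs_le_iff minus_le_iff\<close>)
  have zb: "0 \<le> z i / \<beta> powi i + c \<and> z i / \<beta> powi i + c < 1" for i
  proof (cases "i \<ge> int N")
    case True
    \<comment> \<open>From position N on, the quantity to be bounded is the convex combination of
      \<open>x / \<beta> ^ N + c\<close> and c with weights w and 1 - w.\<close>
    define w where "w = \<beta> ^ N / \<beta> powi i"
    have "\<beta> powi int N \<le> \<beta> powi i" using True \<beta>_gt_1 by (intro power_int_increasing) auto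
    then have w: "0 < w" "w \<le> 1" using \<beta>_pos by (simp_all add: w_def)
    have eq: "z i / \<beta> powi i = x / \<beta> ^ N * w" using True \<beta>_pos by (simp add: z_def w_def)
    have "0 \<le> (x / \<beta> ^ N + c) * w + (1 - w) * c" using w c x by simp
    moreover have "(x / \<beta> ^ N + c) * w < 1 * w" using w x by (intro mult_strict_right_mono)
    moreover have "(1 - w) * c \<le> (1 - w) * 1" using w c by (intro mult_left_mono) auto
    ultimately show ?thesis unfolding eq by (simp add: algebra_simps)
  next
    case False
    then show ?thesis using yb[of "nat (int N - i)"] \<beta>_pos by (simp add: z_def)
  qed
  have vt: "vl (trunc n f) = z n" for n
  proof -
    define M where "M = max (Suc N) (nat (n + 2))"
    have M: "N \<le> M" "0 < M" "n < int M" by (auto simp: M_def)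
    have lim: "(\<lambda>K. \<Sum>i\<in>{- int K..<int M}. (if i < n then D i else 0) * \<beta> powi i) \<longlonglongrightarrow> vl (trunc n f)"
      using digit_sum_tendsto[of N "trunc n f" M] N M bnd_trunc[OF bf]
      unfolding digit_trunc dig by (simp add: trunc_def)
    have "(\<Sum>i\<in>{- int K..<int M}. (if i < n then D i else 0) * \<beta> powi i) = z n - z (- int K)"
      if "K \<ge> nat (- n)" for K
    proof -
      have "(\<Sum>i\<in>{- int K..<int M}. (if i < n then D i else 0) * \<beta> powi i) =
          (\<Sum>i\<in>{- int K..<n}. D i * \<beta> powi i)"
        using M by (intro sum.mono_neutral_cong_right) auto
      also have "\<dots> = z n - z (- int K)" unfolding zD using that by (intro sum_telescope_int) auto
      finally show ?thesis .
    qed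
    moreover have "(\<lambda>K. z (- int K)) \<longlonglongrightarrow> 0"
    proof (rule Lim_null_comparison[OF _ tendsto_div_power[of 1]])
      have "norm (z (- int K)) \<le> 1 / \<beta> ^ K" for K
      proof -
        have "\<bar>z (- int K) / \<beta> powi (- int K)\<bar> \<le> 1" using zb[of "- int K"] c by linarith
        then show ?thesis using \<beta>_pos by (simp add: power_int_minus field_simps abs_mult)
      qed
      then show "\<forall>\<^sub>F K in sequentially. norm (z (- int K)) \<le> 1 / \<beta> ^ K" by simp
    qed
    then have "(\<lambda>K. z n - z (- int K)) \<longlonglongrightarrow> z n - 0" by (intro tendsto_diff tendsto_const)
    moreover from calculation have "\<forall>\<^sub>F K in sequentially. z n - z (- int K) =
        (\<Sum>i\<in>{- int K..<int M}. (if i < n then D i else 0) * \<beta> powi i)"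
      by (intro eventually_sequentiallyI[of "nat (- n)"]) (rule sym)
    ultimately have "(\<lambda>K. \<Sum>i\<in>{- int K..<int M}. (if i < n then D i else 0) * \<beta> powi i) \<longlonglongrightarrow> z n"
      using Lim_transform_eventually by fastforce
    with lim show ?thesis by (rule LIMSEQ_unique)
  qed
  have vf: "vl f = x" using vt[of "int N + 1"] trunc_large[OF N, of "int N + 1"] by (simp add: z_def)
  show ?thesis
  proof (intro exI[of _ f] conjI allI impI)
    show "fin f" using N unfolding fin_def by blast
    show "f n \<in> {-t..t} \<times> {-t..t}" for n using Db t_ge_3 by (simp add: f_def)
    show "f n \<in> {0..t} \<times> {0..t}" if "c = 0" for n using Db t_ge_3 that by (simp add: f_def)
  qed (use vf zb in \<open>simp_all add: vt f_def\<close>)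
qed

lemma canonical_exists:
  "\<exists>f. canonical f \<and> vl f = x \<and> (\<forall>n. f n \<in> {-t..t} \<times> {-t..t})"
proof -
  obtain N where "2 * \<bar>x\<bar> < \<beta> ^ N" using real_arch_pow[OF \<beta>_gt_1] by blast
  then have "0 \<le> x / \<beta> ^ N + 1 / 2" "x / \<beta> ^ N + 1 / 2 < 1"
    using \<beta>_pos by (simp_all add: field_simps abs_if split: if_splits)
  moreover have "0 \<le> (1 / 2 :: real)" "(1 / 2 :: real) < 1" by simp_all
  ultimately have "\<exists>f. fin f \<and> snd (f 0) = 0 \<and> vl f = x \<and>
      (\<forall>n. f n \<in> {-t..t} \<times> {-t..t}) \<and> (1 / 2 = (0::real) \<longrightarrow> (\<forall>n. f n \<in> {0..t} \<times> {0..t})) \<and>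
      (\<forall>n. 0 \<le> vl (trunc n f) / \<beta> powi n + 1 / 2 \<and> vl (trunc n f) / \<beta> powi n + 1 / 2 < 1)"
    by (intro expansion)
  then obtain f where f: "fin f" "snd (f 0) = 0" "vl f = x"
    "\<forall>n. f n \<in> {-t..t} \<times> {-t..t}"
    "\<forall>n. 0 \<le> vl (trunc n f) / \<beta> powi n + 1 / 2 \<and> vl (trunc n f) / \<beta> powi n + 1 / 2 < 1"
    by (elim exE conjE)
  have bf: "bnd f" by (rule bnd_of_digits[of _ t]) (use f(4) in blast)
  have eq: "vl (comb 2 d (trunc n f) (unit_word n)) = 2 * vl (trunc n f) + d * \<beta> powi n" for n d
    using vl_comb[OF fin_trunc[OF f(1)] bnd_trunc[OF bf] fin_unit(1) bnd_unit, of 2 d n n]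
    by (simp add: vl_unit)
  have "- (\<beta> powi n) \<le> 2 * vl (trunc n f) \<and> 2 * vl (trunc n f) < \<beta> powi n" for n
  proof -
    have "0 < \<beta> powi n" using \<beta>_pos by simp
    moreover have "- 1 / 2 \<le> vl (trunc n f) / \<beta> powi n" "vl (trunc n f) / \<beta> powi n < 1 / 2"
      using f(5)[rule_format, of n] by linarith+
    ultimately show ?thesis by (simp add: pos_le_divide_eq pos_divide_less_eq)
  qed
  note bounds = this
  have "0 \<le> 2 * vl (trunc n f) + \<beta> powi n" "2 * vl (trunc n f) - \<beta> powi n < 0" for n
    using bounds[of n] by linarith+
  then have "canonical f" unfolding canonical_def eq using f by (simp add: not_le)
  with f show ?thesis by (intro exI[of _ f]) simp
qed

text \<open>Nonnegative numbers are those with an expansion into nonnegative digits, and by the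
  greedy expansion the digits up to t suffice. An inequality thus becomes a quantifier over words
  followed by a zero test.\<close>

lemma nonneg_iff:
  assumes "fin g" "bnd g"
  shows "0 \<le> vl g \<longleftrightarrow> (\<exists>h. (\<forall>n. h n \<in> {0..t} \<times> {0..t}) \<and> fin (comb 1 (- 1) g h) \<and> vl (comb 1 (- 1) g h) = 0)"
proof -
  have sub: "{0..t} \<times> {0..t} \<subseteq> {-t..t} \<times> {-t..t}" using t_ge_3 by auto
  show ?thesis
  proof
    assume "0 \<le> vl g"
    obtain N where "vl g < \<beta> ^ N" using real_arch_pow[OF \<beta>_gt_1] by blast
    with \<open>0 \<le> vl g\<close> \<beta>_pos have "0 \<le> vl g / \<beta> ^ N + 0" "vl g / \<beta> ^ N + 0 < 1" by simp_all
    from expansion[OF order_refl zero_less_one this]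
    obtain h where h: "fin h" "vl h = vl g" "\<forall>n. h n \<in> {0..t} \<times> {0..t}"
      by (elim exE conjE) simp
    have "bnd h" by (rule bnd_of_digits[of _ t]) (use h sub in blast)
    then show "\<exists>h. (\<forall>n. h n \<in> {0..t} \<times> {0..t}) \<and> fin (comb 1 (- 1) g h) \<and> vl (comb 1 (- 1) g h) = 0"
      using h assms by (intro exI[of _ h]) (simp add: vl_comb fin_comb)
  next
    assume "\<exists>h. (\<forall>n. h n \<in> {0..t} \<times> {0..t}) \<and> fin (comb 1 (- 1) g h) \<and> vl (comb 1 (- 1) g h) = 0"
    then obtain h where h: "\<And>n. h n \<in> {0..t} \<times> {0..t}" "fin (comb 1 (- 1) g h)" "vl (comb 1 (- 1) g h) = 0"
      by blast
    have "bnd h" by (rule bnd_of_digits[of _ t]) (use h sub in blast)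
    \<comment> \<open>Subtracting twice recovers h, so h is finite because g and the difference
      are.\<close>
    have "comb 1 (- 1) g (comb 1 (- 1) g h) = h" by (rule ext) (simp add: comb_def)
    then have fh: "fin h" using fin_comb[OF assms(1) h(2), of 1 "- 1"] by simp
    have "vl g = vl h" using h(3) vl_comb[OF assms fh \<open>bnd h\<close>, of 1 "- 1"] by simp
    also have "0 \<le> vl h" unfolding vl_def
      using h(1) fh \<open>bnd h\<close> \<beta>_pos by (intro add_nonneg_nonneg suminf_nonneg summable_pos summable_neg)
        (auto simp: mem_Times_iff)
    finally show "0 \<le> vl g" .
  qed
qed

section \<open>Integers as values of finite words\<close>

abbreviation mset_word :: "int multiset \<Rightarrow> nat \<Rightarrow> int \<times> int" where
  "mset_word M \<equiv> \<lambda>n. (int (count M (int n)), if n = 0 then 0 else int (count M (- int n)))"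

lemma bnd_mset: "bnd (mset_word M)"
  by (rule bndI[of _ "int (size M)"]) (simp add: count_le_size)

text \<open>A finite word with nonnegative digits is a multiset of integer positions, with
  multiplicities as digits and the size as digit sum. Inserting an element adds a unit word.\<close>

lemma vl_mset:
  "vl (mset_word M) = (\<Sum>i\<in>#M. \<beta> powi i)" "vl (flip (mset_word M)) = (\<Sum>i\<in>#M. \<beta> powi (- i))"
proof -
  have "vl (mset_word M) = (\<Sum>i\<in>#M. \<beta> powi i) \<and> vl (flip (mset_word M)) = (\<Sum>i\<in>#M. \<beta> powi (- i))"
  proof (induction M)
    case empty
    have "mset_word {#} = (\<lambda>_. (0, 0))" by auto
    then show ?case by (simp add: vl_def flip_def)
  next
    case (add i M)
    have eq: "mset_word (add_mset i M) = comb 1 1 (mset_word M) (unit_word i)"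
      by (auto simp: comb_def unit_word_def)
    show ?case unfolding eq flip_comb
      using add vl_comb[OF fin_mset(1) bnd_mset fin_unit(1) bnd_unit, of 1 1 M i]
        vl_comb[OF fin_mset(2) bnd_flip[OF bnd_mset] fin_unit(2) bnd_flip[OF bnd_unit], of 1 1 M i]
      by (simp add: vl_unit vl_flip_unit)
  qed
  then show "vl (mset_word M) = (\<Sum>i\<in>#M. \<beta> powi i)"
    "vl (flip (mset_word M)) = (\<Sum>i\<in>#M. \<beta> powi (- i))" by auto
qed

text \<open>
  Chip firing: since \<open>t \<beta>\<^sup>i = \<beta>\<^bsup>i+1\<^esup> + \<beta>\<^bsup>i-1\<^esup>\<close>, a digit that is at least \<open>t\<close> can be lowered
  by \<open>t\<close> at the cost of one unit at each neighbour, and this lowers the digit sum.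
\<close>

lemma chip_firing:
  "\<exists>M'. (\<forall>i. int (count M' i) \<le> t) \<and> (\<Sum>i\<in>#M'. \<beta> powi i) = (\<Sum>i\<in>#M. \<beta> powi i) \<and>
     (\<Sum>i\<in>#M'. \<beta> powi (- i)) = (\<Sum>i\<in>#M. \<beta> powi (- i))"
proof (induction "size M" arbitrary: M rule: less_induct)
  case less
  show ?case
  proof (cases "\<forall>i. int (count M i) \<le> t")
    case False
    then obtain i where i: "t < int (count M i)" by (meson not_le)
    define T where "T = nat t"
    have T: "int T = t" "real T = t" using t_ge_3 by (simp_all add: T_def)
    have "replicate_mset T i \<subseteq># M" using i T by (simp add: count_le_replicate_mset_subset_eq[symmetric])
    then obtain M0 where M: "M = M0 + replicate_mset T i" by (metis subset_mset.le_iff_add add.commute)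
    define M1 where "M1 = add_mset (i + 1) (add_mset (i - 1) M0)"
    \<comment> \<open>t chips are removed and two are added, so the size drops by t - 2 > 0.\<close>
    have "size M1 < size M" using T t_ge_3 by (simp add: M M1_def)
    from less[OF this] obtain M' where M': "\<forall>i. int (count M' i) \<le> t"
      "(\<Sum>i\<in>#M'. \<beta> powi i) = (\<Sum>i\<in>#M1. \<beta> powi i)"
      "(\<Sum>i\<in>#M'. \<beta> powi (- i)) = (\<Sum>i\<in>#M1. \<beta> powi (- i))" by blast
    have fire: "t * \<beta> powi j = \<beta> powi (j + 1) + \<beta> powi (j - 1)" for j
    proof -
      have "\<beta> powi (j + 1) + \<beta> powi (j - 1) = \<beta> powi j * (\<beta> + 1 / \<beta>)"
        using \<beta>_pos by (simp add: power_int_add power_int_diff algebra_simps)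
      then show ?thesis by (simp add: inverse_\<beta>)
    qed
    have sums: "(\<Sum>i\<in>#M1. c i) = c (i + 1) + c (i - 1) + (\<Sum>i\<in>#M0. c i)"
      "(\<Sum>i\<in>#M. c i) = (\<Sum>i\<in>#M0. c i) + t * c i" for c :: "int \<Rightarrow> real"
      by (simp_all add: M M1_def T)
    \<comment> \<open>The firing relation is symmetric under negation of the exponents, so the same
      move preserves the conjugate sum.\<close>
    have "- (i + 1) = - i - 1" "- (i - 1) = - i + 1" by simp_all
    then have "(\<Sum>i\<in>#M1. \<beta> powi i) = (\<Sum>i\<in>#M. \<beta> powi i)"
      "(\<Sum>i\<in>#M1. \<beta> powi (- i)) = (\<Sum>i\<in>#M. \<beta> powi (- i))"
      unfolding sums fire by (simp_all only: ac_simps)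
    with M' show ?thesis by auto
  qed auto
qed

text \<open>If \<open>\<beta> ^ n\<close> is p + q \<beta> with integers p and q, its conjugate
  \<open>1 / \<beta> ^ n\<close> is p + q / \<beta> with the same p and q. Exchanging the halves of
  a finite word inverts every power and so conjugates the value.\<close>

lemma vl_finite_word:
  assumes "fin f" "fin (flip f)"
  shows "\<exists>(p::int) (q::int). vl f = p + q * \<beta> \<and> vl (flip f) = p + q / \<beta>"
proof -
  have exI2: "P x y \<Longrightarrow> \<exists>x y. P x y" for P :: "int \<Rightarrow> int \<Rightarrow> bool" and x y by blast
  have pw: "\<exists>(p::int) (q::int). \<beta> ^ n = p + q * \<beta> \<and> 1 / \<beta> ^ n = p + q / \<beta>" for n
  proof (induction n)
    case 0
    show ?case by (rule exI[of _ 1], rule exI[of _ 0]) simp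
  next
    case (Suc n)
    then obtain p :: int and q :: int where pq: "\<beta> ^ n = p + q * \<beta>" "1 / \<beta> ^ n = p + q / \<beta>" by blast
    have "\<beta> ^ Suc n = rv (step (p, q))" using pq by (simp add: rv_step) (simp add: rv_def)
    moreover have "1 / \<beta> ^ Suc n = (1 / \<beta> ^ n) / \<beta>" by simp
    then have "1 / \<beta> ^ Suc n = cv (step (p, q))" using pq(2) by (simp only: cv_step) (simp add: cv_def)
    ultimately show ?case unfolding rv_def cv_def by blast
  qed
  have pos: "\<exists>(p::int) (q::int). (\<Sum>n<N. of_int (d n) * \<beta> ^ n) = p + q * \<beta> \<and> (\<Sum>n<N. of_int (d n) / \<beta> ^ n) = p + q / \<beta>"
    for N :: nat and d :: "nat \<Rightarrow> int"
  proof (induction N)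
    case 0
    show ?case by (rule exI[of _ 0], rule exI[of _ 0]) simp
  next
    case (Suc N)
    then obtain p :: int and q :: int where pq: "(\<Sum>n<N. of_int (d n) * \<beta> ^ n) = p + q * \<beta>"
      "(\<Sum>n<N. of_int (d n) / \<beta> ^ n) = p + q / \<beta>" by blast
    obtain p' :: int and q' :: int where pq': "\<beta> ^ N = p' + q' * \<beta>" "1 / \<beta> ^ N = p' + q' / \<beta>" using pw by blast
    have "(\<Sum>n<Suc N. of_int (d n) * \<beta> ^ n) = (p + q * \<beta>) + d N * (p' + q' * \<beta>)"
      unfolding pq[symmetric] pq'[symmetric] by simp
    moreover have "(\<Sum>n<Suc N. of_int (d n) / \<beta> ^ n) = (p + q / \<beta>) + d N * (p' + q' / \<beta>)"
      unfolding pq[symmetric] pq'[symmetric] by simp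
    ultimately show ?case
      by (intro exI2[of _ "p + d N * p'" "q + d N * q'"])
        (simp add: algebra_simps add_divide_distrib)
  qed
  obtain N1 N2 where N: "\<forall>n\<ge>N1. fst (f n) = 0" "\<forall>n\<ge>N2. fst (flip f n) = 0"
    using assms unfolding fin_def by blast
  have 1: "(\<Sum>n. of_int (fst (f n)) * c n) = (\<Sum>n<N1. of_int (fst (f n)) * c n)"
    "(\<Sum>n. of_int (fst (f n)) / c n) = (\<Sum>n<N1. of_int (fst (f n)) / c n)" for c :: "nat \<Rightarrow> real"
    using N(1) by (intro suminf_finite; auto)+
  have 2: "(\<Sum>n. of_int (snd (f n)) * c n) = (\<Sum>n<N2. of_int (snd (f n)) * c n)"
    "(\<Sum>n. of_int (snd (f n)) / c n) = (\<Sum>n<N2. of_int (snd (f n)) / c n)" for c :: "nat \<Rightarrow> real"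
    using N(2) by (intro suminf_finite; auto simp: flip_def)+
  obtain p :: int and q :: int where pq: "(\<Sum>n<N1. of_int (fst (f n)) * \<beta> ^ n) = p + q * \<beta>"
    "(\<Sum>n<N1. of_int (fst (f n)) / \<beta> ^ n) = p + q / \<beta>" using pos[of "\<lambda>n. fst (f n)"] by blast
  obtain p' :: int and q' :: int where pq': "(\<Sum>n<N2. of_int (snd (f n)) * \<beta> ^ n) = p' + q' * \<beta>"
    "(\<Sum>n<N2. of_int (snd (f n)) / \<beta> ^ n) = p' + q' / \<beta>" using pos[of "\<lambda>n. snd (f n)"] by blast
  \<comment> \<open>The second half has \<beta> and \<open>1 / \<beta>\<close> exchanged; the trace
    relation brings it back to the basis of the first half.\<close>
  have conv: "q' / \<beta> = q' * t - q' * \<beta>" "q' * \<beta> = q' * t - q' / \<beta>"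
    using arg_cong[OF inverse_\<beta>, of "(*) (of_int q')"] by (simp_all add: right_diff_distrib)
  have "vl f = (p + p' + q' * t) + (q - q') * \<beta>" "vl (flip f) = (p + p' + q' * t) + (q - q') / \<beta>"
    unfolding vl_def flip_def fst_conv snd_conv 1 2 pq pq'
    using conv by (simp_all add: left_diff_distrib diff_divide_distrib)
  then show ?thesis
    by (intro exI2[of _ "p + p' + q' * t" "q - q'"]) simp
qed

text \<open>For a natural number k, a pile of k chips at position 0 is fired until all digits are at
  most t, which leaves the value and its conjugate at k. Conversely, p + q \<beta> = p + q / \<beta>
  forces q = 0. Only the values of h and its reversal are compared; h itself may be
  asymmetric.\<close>

lemma Ints_iff:
  "x \<in> \<int> \<longleftrightarrow> (\<exists>h. (\<forall>n. h n \<in> {-t..t} \<times> {-t..t}) \<and> fin h \<and> fin (flip h) \<and> vl h = x \<and> vl (flip h) = x)"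
proof
  have nat: "\<exists>h. (\<forall>n. h n \<in> {0..t} \<times> {0..t}) \<and> fin h \<and> fin (flip h) \<and> bnd h \<and> vl h = real k \<and> vl (flip h) = real k" for k
  proof -
    obtain M where M: "\<forall>i. int (count M i) \<le> t" "(\<Sum>i\<in>#M. \<beta> powi i) = (\<Sum>i\<in>#replicate_mset k 0. \<beta> powi i)"
      "(\<Sum>i\<in>#M. \<beta> powi (- i)) = (\<Sum>i\<in>#replicate_mset k 0. \<beta> powi (- i))"
      using chip_firing by blast
    then show ?thesis using fin_mset[of M] bnd_mset[of M] vl_mset[of M] t_ge_3
      by (intro exI[of _ "mset_word M"]) simp
  qed
  assume "x \<in> \<int>"
  then obtain z :: int where z: "x = z" by (elim Ints_cases)
  obtain h where h: "\<forall>n. h n \<in> {0..t} \<times> {0..t}" "fin h" "fin (flip h)" "bnd h"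
    "vl h = real (nat \<bar>z\<bar>)" "vl (flip h) = real (nat \<bar>z\<bar>)" using nat by blast
  \<comment> \<open>Negative integers are reached by negating all digits.\<close>
  define g where "g = comb (sgn z) 0 h h"
  have sg: "sgn z = 1 \<or> sgn z = 0 \<or> sgn z = - 1" by (simp add: sgn_if)
  have "g n \<in> {-t..t} \<times> {-t..t}" for n
    using h(1)[rule_format, of n] sg t_ge_3 by (auto simp: g_def comb_def mem_Times_iff)
  moreover have "fin g" "fin (flip g)" using h by (simp_all add: g_def flip_comb fin_comb)
  moreover have "vl g = x" "vl (flip g) = x"
    using h sg by (auto simp: g_def flip_comb vl_comb bnd_flip z sgn_if)
  ultimately show "\<exists>h. (\<forall>n. h n \<in> {-t..t} \<times> {-t..t}) \<and> fin h \<and> fin (flip h) \<and> vl h = x \<and> vl (flip h) = x"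
    by blast
next
  assume "\<exists>h. (\<forall>n. h n \<in> {-t..t} \<times> {-t..t}) \<and> fin h \<and> fin (flip h) \<and> vl h = x \<and> vl (flip h) = x"
  then obtain h where h: "\<And>n. h n \<in> {-t..t} \<times> {-t..t}" "fin h" "fin (flip h)" "vl h = x" "vl (flip h) = x" by blast
  from vl_finite_word[OF h(2,3)] h obtain p :: int and q :: int where "x = p + q * \<beta>" "x = p + q / \<beta>" by auto
  then have "q * (\<beta> - 1 / \<beta>) = 0" by (simp add: algebra_simps)
  moreover have "1 / \<beta> < 1" using \<beta>_gt_1 by simp
  ultimately have "q = 0" using \<beta>_gt_1 by auto
  with \<open>x = p + q * \<beta>\<close> show "x \<in> \<int>" by simp
qed

lemma fin_bnd_vl_shift_up:
  assumes "fin h" "bnd h"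
  shows "fin (shift_up h)" "bnd (shift_up h)" "vl (shift_up h) = \<beta> * vl h"
proof -
  obtain N where N: "\<forall>n\<ge>N. fst (h n) = 0" using assms unfolding fin_def by blast
  have "fst (shift_up h n) = 0" if "n \<ge> Suc (Suc N)" for n
  proof -
    obtain m where "n = Suc (Suc m)" "m \<ge> N" using \<open>n \<ge> Suc (Suc N)\<close> by (metis Suc_le_D Suc_le_mono)
    with N show ?thesis by (simp add: shift_up_def)
  qed
  then show fin: "fin (shift_up h)" unfolding fin_def by blast
  obtain B where B: "0 \<le> B" "\<And>n. \<bar>fst (h n)\<bar> \<le> B" "\<And>n. \<bar>snd (h n)\<bar> \<le> B" using assms bndE by blast
  show bnd: "bnd (shift_up h)"
  proof (rule bndI[of _ "2 * B"])
    fix n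
    have "\<bar>fst (h m) + (if m = 0 then snd (h 0) else 0)\<bar> \<le> 2 * B" for m
      using B(2)[of m] B(3)[of 0] B(1) by auto
    then show "\<bar>fst (shift_up h n)\<bar> \<le> 2 * B \<and> \<bar>snd (shift_up h n)\<bar> \<le> 2 * B"
      using B(1) B(3)[of "Suc n"] by (auto simp: shift_up_def split: nat.splits)
  qed
  have "(\<Sum>n. of_int (fst (shift_up h n)) * \<beta> ^ n) =
      (\<Sum>n. of_int (fst (shift_up h (Suc n))) * \<beta> ^ Suc n)"
    using suminf_split_head[OF summable_pos[OF fin]] by (simp add: shift_up_def)
  also have "\<dots> = (\<Sum>n. \<beta> * (of_int (fst (h n)) * \<beta> ^ n) + (if n = 0 then \<beta> * snd (h 0) else 0))"
    by (intro arg_cong[of _ _ suminf] ext) (simp add: shift_up_def algebra_simps)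
  also have "\<dots> = (\<Sum>n. \<beta> * (of_int (fst (h n)) * \<beta> ^ n)) + (\<Sum>n. (if n = 0 then \<beta> * snd (h 0) else 0))"
    by (intro suminf_add[symmetric] summable_mult summable_pos assms summable_finite[of "{0}"]) auto
  also have "(\<Sum>n. (if n = 0 then \<beta> * snd (h 0) else 0)) = \<beta> * snd (h 0)"
    using suminf_finite[of "{0}" "\<lambda>n. (if n = 0 then \<beta> * snd (h 0) else 0)"] by simp
  also have "(\<Sum>n. \<beta> * (of_int (fst (h n)) * \<beta> ^ n)) = \<beta> * (\<Sum>n. of_int (fst (h n)) * \<beta> ^ n)"
    by (rule suminf_mult) (rule summable_pos[OF assms(1)])
  finally have 1: "(\<Sum>n. of_int (fst (shift_up h n)) * \<beta> ^ n) =
    \<beta> * (\<Sum>n. of_int (fst (h n)) * \<beta> ^ n) + \<beta> * of_int (snd (h 0))" .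
  have sm: "summable (\<lambda>n. of_int (snd (h n)) / \<beta> ^ n)" by (rule summable_neg[OF assms(2)])
  have "(\<Sum>n. of_int (snd (shift_up h n)) / \<beta> ^ n) = (\<Sum>n. \<beta> * (of_int (snd (h (Suc n))) / \<beta> ^ Suc n))"
    using \<beta>_pos by (simp add: shift_up_def)
  also have "\<dots> = \<beta> * (\<Sum>n. of_int (snd (h (Suc n))) / \<beta> ^ Suc n)"
    using sm by (intro suminf_mult) (subst summable_Suc_iff)
  also have "(\<Sum>n. of_int (snd (h (Suc n))) / \<beta> ^ Suc n) = (\<Sum>n. of_int (snd (h n)) / \<beta> ^ n) - of_int (snd (h 0))"
    using suminf_split_head[OF sm] by simp
  finally have 2: "(\<Sum>n. of_int (snd (shift_up h n)) / \<beta> ^ n) =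
      \<beta> * ((\<Sum>n. of_int (snd (h n)) / \<beta> ^ n) - of_int (snd (h 0)))" .
  show "vl (shift_up h) = \<beta> * vl h" unfolding vl_def 1 2 by (simp add: algebra_simps)
qed

end

section \<open>Quadratic numbers and Pell's equation\<close>

text \<open>Dirichlet approximation provides infinitely many reduced fractions h / k with bounded
  norm \<open>h\<^sup>2 - D * k\<^sup>2\<close>. By the pigeonhole principle two of them share the
  norm n and the residues of h and k modulo n; the quotient of the corresponding numbers h + k sqrt
  D then has integer coefficients and norm 1.\<close>

lemma pell_solution:
  fixes D :: int
  assumes "D > 0" "sqrt D \<notin> \<rat>"
  obtains u v :: int where "u > 0" "v > 0" "u\<^sup>2 - D * v\<^sup>2 = 1"
proof -
  define N where "N = (\<lambda>(h, k). h\<^sup>2 - D * k\<^sup>2)"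
  define \<phi> where "\<phi> = (\<lambda>x. (N x, fst x mod N x, snd x mod N x))"
  \<comment> \<open>Product of the bounds 1 / k for \<bar>k sqrt D - h\<bar> and k (2 sqrt D + 1)
    for \<bar>k sqrt D + h\<bar>, rounded up.\<close>
  define C where "C = \<lceil>2 * sqrt D + 1\<rceil>"
  have N_bound: "\<bar>N (h, k)\<bar> \<le> C" "N (h, k) \<noteq> 0" if hk: "(h, k) \<in> approx_set (sqrt D)" for h k
  proof -
    have k: "0 < k" "\<bar>sqrt D - h / k\<bar> < 1 / (of_int k)\<^sup>2" using hk by (auto simp: approx_set_def)
    have "\<bar>k * sqrt D - h\<bar> = \<bar>k * (sqrt D - h / k)\<bar>" using k(1) by (simp add: right_diff_distrib)
    also have "\<dots> = k * \<bar>sqrt D - h / k\<bar>" using k(1) by (simp add: abs_mult)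
    also have "\<dots> \<le> k * (1 / (of_int k)\<^sup>2)" using k by (intro mult_left_mono) auto
    also have "\<dots> = 1 / k" using k(1) by (simp add: power2_eq_square)
    finally have d: "\<bar>k * sqrt D - h\<bar> \<le> 1 / k" .
    have k1: "1 / k \<le> (1::real)" using k(1) by simp
    have "\<bar>k * sqrt D + h\<bar> \<le> \<bar>2 * k * sqrt D\<bar> + \<bar>k * sqrt D - h\<bar>" by linarith
    also have "\<dots> \<le> 2 * k * sqrt D + k"
    proof -
      have "\<bar>2 * k * sqrt D\<bar> = 2 * k * sqrt D" using k(1) assms(1) by simp
      moreover have "(1::real) \<le> k" using k(1) by simp
      ultimately show ?thesis using d k1 by linarith
    qed
    finally have s: "\<bar>k * sqrt D + h\<bar> \<le> k * (2 * sqrt D + 1)" by (simp add: algebra_simps)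
    have sq: "sqrt D * sqrt D = D" using assms(1) by simp
    have "real_of_int (N (h, k)) = - ((k * sqrt D - h) * (k * sqrt D + h))"
      using sq by (simp add: N_def) (simp add: algebra_simps power2_eq_square)
    then have "\<bar>real_of_int (N (h, k))\<bar> = \<bar>k * sqrt D - h\<bar> * \<bar>k * sqrt D + h\<bar>" by (simp add: abs_mult)
    also have "\<dots> \<le> (1 / k) * (k * (2 * sqrt D + 1))"
      using d s k(1) by (intro mult_mono) auto
    also have "\<dots> = 2 * sqrt D + 1" using k(1) by simp
    finally have "\<bar>real_of_int (N (h, k))\<bar> \<le> 2 * sqrt D + 1" .
    then show "\<bar>N (h, k)\<bar> \<le> C" unfolding C_def by linarith
    show "N (h, k) \<noteq> 0"
    proof
      assume "N (h, k) = 0"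
      then have "real_of_int (h\<^sup>2) = real_of_int (D * k\<^sup>2)" by (simp add: N_def)
      then have "D = (h / k)\<^sup>2" using k(1) by (simp add: power_divide)
      then have "sqrt D = \<bar>h / k\<bar>" by simp
      then have "sqrt D \<in> \<rat>" by simp
      with assms(2) show False ..
    qed
  qed
  have "\<phi> ` approx_set (sqrt D) \<subseteq> {-C..C} \<times> {-C..C} \<times> {-C..C}"
  proof (rule image_subsetI)
    fix x assume "x \<in> approx_set (sqrt D)"
    then obtain h k where x: "x = (h, k)" and hk: "(h, k) \<in> approx_set (sqrt D)" by (cases x) auto
    have "\<bar>y mod N (h, k)\<bar> \<le> C" for y
      using abs_mod_less[OF N_bound(2)[OF hk], of y] N_bound(1)[OF hk] by linarith
    then show "\<phi> x \<in> {-C..C} \<times> {-C..C} \<times> {-C..C}"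
      using N_bound(1)[OF hk] by (simp add: x \<phi>_def abs_le_iff minus_le_iff)
  qed
  then have "finite (\<phi> ` approx_set (sqrt D))" by (rule finite_subset) simp
  moreover have "infinite (approx_set (sqrt D))"
    using assms(2) rational_iff_finite_approx_set by blast
  ultimately have "\<not> inj_on \<phi> (approx_set (sqrt D))" using finite_imageD by blast
  then obtain h1 k1 h2 k2 where 1: "(h1, k1) \<in> approx_set (sqrt D)" and 2: "(h2, k2) \<in> approx_set (sqrt D)"
    and ne: "(h1, k1) \<noteq> (h2, k2)" and eq: "\<phi> (h1, k1) = \<phi> (h2, k2)"
    unfolding inj_on_def by auto
  define n where "n = N (h1, k1)"
  have e: "N (h2, k2) = n" "h1 mod n = h2 mod n" "k1 mod n = k2 mod n"
    using eq by (auto simp: n_def \<phi>_def)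
  have n: "n \<noteq> 0" "h1\<^sup>2 - D * k1\<^sup>2 = n" "h2\<^sup>2 - D * k2\<^sup>2 = n"
    using N_bound(2)[OF 1] e(1) by (simp_all add: n_def N_def)
  obtain a where a: "h2 = h1 + n * a" using e(2) by (rule mod_eqE)
  obtain b where b: "k2 = k1 + n * b" using e(3) by (rule mod_eqE)
  note ab = a b
  \<comment> \<open>\<open>n * u\<close> and \<open>n * v\<close> are the coefficients of (h1 - k1
    sqrt D) (h2 + k2 sqrt D); the congruences modulo n make them divisible by n.\<close>
  define u where "u = 1 + h1 * a - D * k1 * b"
  define v where "v = h1 * b - a * k1"
  have "h1 * h2 - D * k1 * k2 = (h1\<^sup>2 - D * k1\<^sup>2) + n * (h1 * a - D * k1 * b)"
    unfolding ab by (simp add: algebra_simps power2_eq_square)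
  then have u: "h1 * h2 - D * k1 * k2 = n * u" unfolding n(2) u_def by (simp add: algebra_simps)
  have v: "h1 * k2 - h2 * k1 = n * v" unfolding v_def ab by (simp add: algebra_simps)
  have "(n * u)\<^sup>2 - D * (n * v)\<^sup>2 = (h1\<^sup>2 - D * k1\<^sup>2) * (h2\<^sup>2 - D * k2\<^sup>2)"
    unfolding u[symmetric] v[symmetric] by (simp add: algebra_simps power2_eq_square)
  then have "(n * u)\<^sup>2 - D * (n * v)\<^sup>2 = n * n" unfolding n(2,3) .
  then have "n\<^sup>2 * (u\<^sup>2 - D * v\<^sup>2) = n\<^sup>2 * 1" by (simp add: algebra_simps power2_eq_square)
  then have pell: "u\<^sup>2 - D * v\<^sup>2 = 1" using n(1) by simp
  \<comment> \<open>Otherwise the two fractions are equal, and reduced fractions with positive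
    denominators are then the same pair.\<close>
  have "v \<noteq> 0"
  proof
    assume "v = 0"
    then have e: "h1 * k2 = h2 * k1" using v by simp
    have c: "coprime h1 k1" "coprime h2 k2" "0 < k1" "0 < k2" using 1 2 by (auto simp: approx_set_def)
    have "k1 dvd h1 * k2" "k2 dvd h2 * k1" using e by (metis dvd_triv_right)+
    then have "k1 dvd k2" "k2 dvd k1" using c by (simp_all add: coprime_dvd_mult_right_iff coprime_commute)
    then have "k1 = k2" using c by (simp add: zdvd_antisym_nonneg)
    with e c ne show False by simp
  qed
  moreover have "u \<noteq> 0"
  proof
    assume "u = 0"
    moreover have "0 \<le> D * v\<^sup>2" using assms(1) by simp
    ultimately show False using pell by simp
  qed
  ultimately show thesis using that[of "\<bar>u\<bar>" "\<bar>v\<bar>"] pell by simp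
qed

lemma quadratic_integer_equation:
  fixes a :: real
  assumes "quadratic a"
  obtains A B C :: int where "A \<noteq> 0" "A * a\<^sup>2 + B * a + C = 0"
proof -
  obtain p q r :: rat where pqr: "p \<noteq> 0" "of_rat p * a\<^sup>2 + of_rat q * a + of_rat r = 0"
    using assms unfolding quadratic_def by (elim exE conjE)
  obtain p1 p2 where p: "p = Fract p1 p2" "p2 > 0" by (rule Rat_cases[of p])
  obtain q1 q2 where q: "q = Fract q1 q2" "q2 > 0" by (rule Rat_cases[of q])
  obtain r1 r2 where r: "r = Fract r1 r2" "r2 > 0" by (rule Rat_cases[of r])
  define P Q R where "P = real_of_int p1 / of_int p2" and "Q = real_of_int q1 / of_int q2"
    and "R = real_of_int r1 / of_int r2"
  have "of_rat p = P" "of_rat q = Q" "of_rat r = R"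
    using p(2) q(2) r(2) unfolding p(1) q(1) r(1) P_def Q_def R_def by (simp_all add: of_rat_rat)
  then have eq: "P * a\<^sup>2 + Q * a + R = 0" using pqr(2) by simp
  have "of_int p1 = P * of_int p2" "of_int q1 = Q * of_int q2" "of_int r1 = R * of_int r2"
    using p(2) q(2) r(2) by (simp_all add: P_def Q_def R_def)
  then have "of_int (p1 * q2 * r2) * a\<^sup>2 + of_int (q1 * p2 * r2) * a + of_int (r1 * p2 * q2) =
      (P * a\<^sup>2 + Q * a + R) * (of_int p2 * of_int q2 * of_int r2)"
    by (simp add: algebra_simps)
  then have "of_int (p1 * q2 * r2) * a\<^sup>2 + of_int (q1 * p2 * r2) * a + of_int (r1 * p2 * q2) = 0"
    unfolding eq by simp
  moreover have "p1 * q2 * r2 \<noteq> 0" using pqr(1) p q(2) r(2) by (auto simp: rat_number_collapse)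
  ultimately show thesis by (intro that)
qed

text \<open>\<open>2 * A * a + B\<close> is a square root s of the discriminant D. For irrational s
  a Pell solution gives the unit u + v sqrt D of trace 2 u. For rational s the number a is rational,
  and the unit of trace 3 is taken with k = 0.\<close>

lemma quadratic_unit:
  fixes a :: real
  assumes "quadratic a"
  obtains t m n k :: int and \<beta> :: real
  where "unit_base t \<beta>" "m \<noteq> 0" "m * a = n + k * \<beta>"
proof -
  obtain A B C :: int where A: "A \<noteq> 0" and eq: "A * a\<^sup>2 + B * a + C = 0"
    using quadratic_integer_equation[OF assms] by blast
  define s where "s = 2 * A * a + B"
  define D where "D = B\<^sup>2 - 4 * A * C"
  have s2: "s\<^sup>2 = D" unfolding s_def D_def using eq
    by (simp add: power2_eq_square) algebra
  show thesis
  proof (cases "s \<in> \<rat>")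
    case True
    then obtain x y :: int where xy: "s = x / y" "y \<noteq> 0" by (metis Rats_cases' order_less_irrefl)
    have "sqrt 5 * sqrt 5 = (5::real)" by simp
    moreover have "0 < 1 + sqrt (5::real)" by (simp add: add_pos_pos)
    ultimately have "unit_base 3 ((3 + sqrt 5) / 2)"
      by unfold_locales (simp_all add: power2_eq_square field_simps)
    moreover have "of_int (2 * A * y) * a = of_int (x - B * y) + of_int 0 * ((3 + sqrt 5) / 2)"
      using xy s_def by (simp add: field_simps)
    ultimately show ?thesis using A xy(2) that[of 3 "(3 + sqrt 5) / 2" "2 * A * y" "x - B * y" 0] by simp
  next
    case False
    have "s \<noteq> 0" using False by auto
    then have "0 < s\<^sup>2" by simp
    then have "D > 0" using s2 by simp
    \<comment> \<open>\<open>sqrt D\<close> is \<bar>s\<bar>, so the sign of s enters the relation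
      between a and \<beta>.\<close>
    define \<sigma> :: int where "\<sigma> = (if s > 0 then 1 else - 1)"
    have sD: "sqrt D = \<sigma> * s" unfolding s2[symmetric] using \<open>s \<noteq> 0\<close> by (simp add: \<sigma>_def)
    then have "sqrt D \<notin> \<rat>" using False by (auto simp: \<sigma>_def)
    with \<open>D > 0\<close> obtain u v :: int where uv: "u > 0" "v > 0" "u\<^sup>2 - D * v\<^sup>2 = 1"
      by (rule pell_solution)
    define \<beta> where "\<beta> = u + v * sqrt D"
    have "0 < D * v\<^sup>2" using uv \<open>D > 0\<close> by simp
    then have "u \<noteq> 1" using uv(3) by auto
    then have "u \<ge> 2" using uv(1) by linarith
    moreover have "0 < v * sqrt D" using uv(2) \<open>D > 0\<close> by simp
    moreover have "\<beta>\<^sup>2 = of_int (2 * u) * \<beta> - 1"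
    proof -
      have "real_of_int (u\<^sup>2 - D * v\<^sup>2) = 1" using uv(3) by simp
      then have "(of_int u)\<^sup>2 - of_int D * (of_int v)\<^sup>2 = (1::real)" by simp
      moreover have "(v * sqrt D)\<^sup>2 = of_int D * (of_int v)\<^sup>2"
        using \<open>D > 0\<close> by (simp add: power_mult_distrib)
      moreover have "\<beta>\<^sup>2 = (of_int u)\<^sup>2 + (v * sqrt D)\<^sup>2 + 2 * of_int u * (v * sqrt D)"
        unfolding \<beta>_def by (rule power2_sum)
      moreover have "of_int (2 * u) * \<beta> = 2 * (of_int u)\<^sup>2 + 2 * of_int u * (v * sqrt D)"
        unfolding \<beta>_def by (simp add: algebra_simps power2_eq_square)
      ultimately show ?thesis by linarith
    qed
    moreover have "1 < \<beta>"
    proof -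
      have "2 \<le> real_of_int u" using \<open>u \<ge> 2\<close> by simp
      then show ?thesis using \<open>0 < v * sqrt D\<close> unfolding \<beta>_def by linarith
    qed
    ultimately have "unit_base (2 * u) \<beta>" by unfold_locales auto
    \<comment> \<open>2 A v a = v s - B v, and v s = \<sigma> (\<beta> - u).\<close>
    moreover have "of_int (2 * A * v) * a = of_int (- \<sigma> * u - B * v) + of_int \<sigma> * \<beta>"
    proof -
      have "of_int \<sigma> * \<beta> = \<sigma> * u + v * s"
        unfolding \<beta>_def sD by (simp add: \<sigma>_def algebra_simps)
      then show ?thesis by (simp add: s_def algebra_simps)
    qed
    ultimately show ?thesis using A uv(2) that[of "2 * u" \<beta> "2 * A * v" "- \<sigma> * u - B * v" \<sigma>] by simp
  qed
qed

section \<open>Definability of the structure on canonical words\<close>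

lemma mso_word_pair: "mso_word f \<Longrightarrow> mso_word g \<Longrightarrow> mso_word (\<lambda>e E n. (f e E n, g e E n))"
  by (rule mso_word_map2)

lemma mso_eventually:
  assumes "mso_word p"
  shows "mso (\<lambda>e E. \<exists>N. \<forall>n\<ge>N. A (p e E n))"
proof -
  have "mso_fun (\<lambda>e E. p (\<lambda>i. e (Suc (Suc i))) E (e 0))"
    using mso_fun_nth[OF mso_word_rename[OF assms, of "\<lambda>i. Suc (Suc i)" id], of 0] by simp
  then have "mso (\<lambda>e E. A (p (\<lambda>i. e (Suc (Suc i))) E (e 0)))" by (rule mso_of_fun)
  then have "mso (\<lambda>e E. e (Suc 0) \<le> e 0 \<longrightarrow> A (p (\<lambda>i. e (Suc (Suc i))) E (e 0)))"
    by (rule mso_imp[OF mso_le])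
  then have "mso (\<lambda>e E. \<forall>n. e 0 \<le> n \<longrightarrow> A (p (\<lambda>i. e (Suc i)) E n))" by (rule mso_allN)
  then show ?thesis by (rule mso_exN)
qed

text \<open>Pairs of neighbouring letters again form a word over a finite alphabet, so any
  transition relation A is admissible.\<close>

lemma mso_all_adjacent:
  assumes "mso_word p"
  shows "mso (\<lambda>e E. \<forall>n. A (p e E n) (p e E (Suc n)))"
proof -
  have w: "mso_word (\<lambda>e E n. (p e E n, p e E (Suc n)))"
    by (rule mso_word_pair[OF assms mso_word_Suc[OF assms]])
  have "mso (\<lambda>e E. case (p (\<lambda>i. e (Suc i)) E (e 0), p (\<lambda>i. e (Suc i)) E (Suc (e 0))) of (x, y) \<Rightarrow> A x y)"
    by (rule mso_of_fun[OF w[unfolded mso_word_def]])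
  then have "mso (\<lambda>e E. A (p (\<lambda>i. e (Suc i)) E (e 0)) (p (\<lambda>i. e (Suc i)) E (Suc (e 0))))"
    by (simp only: prod.case)
  then show ?thesis by (rule mso_allN)
qed

lemma mso_fin: "mso_word g \<Longrightarrow> mso (\<lambda>e E. fin (g e E))"
  unfolding fin_def by (rule mso_eventually)

text \<open>The range is finite uniformly in the environment. One bound thus serves all words
  produced by g, and one finite set of states serves all their runs.\<close>

lemma mso_word_bound:
  assumes "mso_word g"
  obtains B :: int where "\<And>e E n. \<bar>fst (g e E n)\<bar> \<le> B" "\<And>e E n. \<bar>snd (g e E n)\<bar> \<le> B"
proof -
  obtain Q where Q: "finite Q" "\<And>e E n. g e E n \<in> Q" by (rule mso_word_finite[OF assms]) blast
  define S where "S = (\<lambda>x. \<bar>fst x\<bar>) ` Q \<union> (\<lambda>x. \<bar>snd x\<bar>) ` Q"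
  have "finite S" using Q(1) by (simp add: S_def)
  moreover have "\<bar>fst (g e E n)\<bar> \<in> S" "\<bar>snd (g e E n)\<bar> \<in> S" for e E n
    using Q(2)[of e E n] by (auto simp: S_def)
  ultimately show thesis by (intro that[of "Max S"] Max_ge)
qed

lemma mso_word_bnd: "mso_word g \<Longrightarrow> bnd (g e E)"
  by (erule mso_word_bound) (blast intro: bndI)

lemma mso_word_comb: "mso_word f \<Longrightarrow> mso_word g \<Longrightarrow> mso_word (\<lambda>e E. comb c d (f e E) (g e E))"
  unfolding comb_def by (rule mso_word_map2)

lemma mso_word_flip: "mso_word f \<Longrightarrow> mso_word (\<lambda>e E. flip (f e E))"
  unfolding flip_def by (rule mso_word_map)

lemma mso_word_shift_up:
  assumes "mso_word h"
  shows "mso_word (\<lambda>e E. shift_up (h e E))"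
proof -
  define f1 where "f1 = (\<lambda>e E n. case n of 0 \<Rightarrow> (0, 0) | Suc m \<Rightarrow> h e E m)"
  \<comment> \<open>A marker for position 1, where \<open>snd (h 0)\<close> is added.\<close>
  define f2 where "f2 = (\<lambda>(e::nat \<Rightarrow> nat) (E::nat \<Rightarrow> nat set) n. case n of 0 \<Rightarrow> False | Suc m \<Rightarrow> (m = 0))"
  have 1: "mso_word f1" unfolding f1_def by (rule mso_word_pred[OF assms])
  have "mso_word (\<lambda>(e::nat \<Rightarrow> nat) (E::nat \<Rightarrow> nat set) n. n = 0)"
    unfolding mso_word_def by (rule mso_fun_of_bool[OF mso_eq_0])
  then have 2: "mso_word f2" unfolding f2_def by (rule mso_word_pred)
  have eq: "shift_up (h e E) n = (fst (f1 e E n) + (if f2 e E n then snd (f1 e E n) else 0), snd (h e E (Suc n)))"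
    for e E n by (auto simp: shift_up_def f1_def f2_def split: nat.splits)
  show ?thesis unfolding eq
    using mso_word_map2[OF mso_word_pair[OF 1 2] mso_word_Suc[OF assms],
        of "\<lambda>x y. (fst (fst x) + (if snd x then snd (fst x) else 0), snd y)"]
    by (simp only: fst_conv snd_conv)
qed

context unit_base
begin

lemma mso_run:
  assumes "mso_word g" "mso_word r"
  shows "mso (\<lambda>e E. run (g e E) (r e E))"
proof -
  define p where "p = (\<lambda>e E n. (g e E n, r e E n))"
  have p: "mso_word p" unfolding p_def by (rule mso_word_pair[OF assms])
  have "run (g e E) (r e E) \<longleftrightarrow>
     (\<exists>N. \<forall>n\<ge>N. (\<lambda>x. fst (snd x) = (0, 0) \<and> fst (fst x) = 0) (p e E n)) \<and>
     (\<lambda>x. snd (snd x) = plus_int (fst (snd x)) (snd (fst x))) (p e E 0) \<and>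
     (\<forall>n. (\<lambda>x y. fst (snd x) = plus_int (step (fst (snd y))) (fst (fst x)) \<and>
          snd (snd y) = plus_int (step (snd (snd x))) (snd (fst y))) (p e E n) (p e E (Suc n)))" for e E
    by (simp add: run_def p_def)
  moreover have "mso (\<lambda>e E.
     (\<exists>N. \<forall>n\<ge>N. (\<lambda>x. fst (snd x) = (0, 0) \<and> fst (fst x) = 0) (p e E n)) \<and>
     (\<lambda>x. snd (snd x) = plus_int (fst (snd x)) (snd (fst x))) (p e E 0) \<and>
     (\<forall>n. (\<lambda>x y. fst (snd x) = plus_int (step (fst (snd y))) (fst (fst x)) \<and>
          snd (snd y) = plus_int (step (snd (snd x))) (snd (fst y))) (p e E n) (p e E (Suc n))))"
    by (rule mso_conj[OF mso_eventually[OF p] mso_conj[OF mso_of_fun[OF mso_fun_nth_0[OF p]] mso_all_adjacent[OF p]]])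
  ultimately show ?thesis by (simp only:)
qed

text \<open>Finiteness is part of the relation because the series behind \<open>vl\<close>
  represents a value only for finite first halves; the existence of a run yields both
  conjuncts.\<close>

lemma mso_zero:
  assumes "mso_word g"
  shows "mso (\<lambda>e E. fin (g e E) \<and> vl (g e E) = 0)"
proof -
  obtain B where B: "\<And>e E n. \<bar>fst (g e E n)\<bar> \<le> B" "\<And>e E n. \<bar>snd (g e E n)\<bar> \<le> B"
    by (rule mso_word_bound[OF assms]) blast
  define C where "C = 3 * B * (1 + 2 * t)"
  have "fin (g e E) \<and> vl (g e E) = 0 \<longleftrightarrow> (\<exists>r. (\<forall>n. r n \<in> box C) \<and> run (g e E) r)" for e E
  proof
    assume "fin (g e E) \<and> vl (g e E) = 0"
    then show "\<exists>r. (\<forall>n. r n \<in> box C) \<and> run (g e E) r"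
      unfolding C_def by (intro run_of_vl_zero B) auto
  next
    assume "\<exists>r. (\<forall>n. r n \<in> box C) \<and> run (g e E) r"
    then obtain r where r: "\<forall>n. r n \<in> box C" "run (g e E) r" by (elim exE conjE)
    have "fin (g e E)" using r(2) unfolding run_def fin_def by blast
    moreover have "vl (g e E) = 0" by (rule vl_zero_of_run[OF r(2)]) (use r(1) mso_word_bnd[OF assms] in auto)
    ultimately show "fin (g e E) \<and> vl (g e E) = 0" by blast
  qed
  moreover have "mso (\<lambda>e E. \<exists>r. (\<forall>n. r n \<in> box C) \<and> run (g e E) r)"
  proof (rule mso_ex_word)
    show "finite (box C)" by (simp add: box_def)
    fix r :: "(nat \<Rightarrow> nat set) \<Rightarrow> nat \<Rightarrow> (int \<times> int) \<times> (int \<times> int)" and L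
    assume "mso_word (\<lambda>e. r)"
    moreover have "mso_word (\<lambda>e E. g e (\<lambda>i. E (i + L)))"
      using mso_word_rename[OF assms, of id "\<lambda>i. i + L"] by simp
    ultimately show "mso (\<lambda>e E. run (g e (\<lambda>i. E (i + L))) (r E))" by (intro mso_run)
  qed
  ultimately show ?thesis by (simp only:)
qed

lemma mso_nonneg:
  assumes "mso_word g"
  shows "mso (\<lambda>e E. fin (g e E) \<and> 0 \<le> vl (g e E))"
proof -
  have "fin (g e E) \<and> 0 \<le> vl (g e E) \<longleftrightarrow> (\<exists>h. (\<forall>n. h n \<in> {0..t} \<times> {0..t}) \<and>
      (fin (g e E) \<and> fin (comb 1 (- 1) (g e E) h) \<and> vl (comb 1 (- 1) (g e E) h) = 0))" for e E
    using nonneg_iff[OF _ mso_word_bnd[OF assms], of e E] by auto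
  moreover have "mso (\<lambda>e E. \<exists>h. (\<forall>n. h n \<in> {0..t} \<times> {0..t}) \<and>
      (fin (g e E) \<and> fin (comb 1 (- 1) (g e E) h) \<and> vl (comb 1 (- 1) (g e E) h) = 0))"
  proof (rule mso_ex_word)
    fix r :: "(nat \<Rightarrow> nat set) \<Rightarrow> nat \<Rightarrow> int \<times> int" and L
    assume r: "mso_word (\<lambda>e. r)"
    have g: "mso_word (\<lambda>e E. g e (\<lambda>i. E (i + L)))"
      using mso_word_rename[OF assms, of id "\<lambda>i. i + L"] by simp
    show "mso (\<lambda>e E. fin (g e (\<lambda>i. E (i + L))) \<and> fin (comb 1 (- 1) (g e (\<lambda>i. E (i + L))) (r E)) \<and>
        vl (comb 1 (- 1) (g e (\<lambda>i. E (i + L))) (r E)) = 0)"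
      by (rule mso_conj[OF mso_fin[OF g] mso_zero[OF mso_word_comb[OF g r]]])
  qed simp
  ultimately show ?thesis by (simp only:)
qed

text \<open>Truncation points are integers while number variables range over \<nat>, so n and -n are
  treated separately. The letter of the combination at j depends only on the letter of the word at j
  and on how j compares with n and 0, which is finitely much information.\<close>

lemma mso_canonical:
  assumes "mso_word g"
  shows "mso (\<lambda>e E. canonical (g e E))"
proof -
  define T where "T d z f = comb 2 d (trunc z f) (unit_word z)" for d z f
  define pos where "pos d z f \<longleftrightarrow> fin (T d z f) \<and> 0 \<le> vl (T d z f)" for d z f
  have g: "mso_fun (\<lambda>e E. g (\<lambda>i. e (Suc (Suc i))) E (e 0))"
    using mso_fun_nth[OF mso_word_rename[OF assms, of "\<lambda>i. Suc (Suc i)" id], of 0] by simp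
  \<comment> \<open>Variable 0 is the position j of the letter, variable 1 is the truncation point
    n.\<close>
  have cmp: "mso_fun (\<lambda>e E. (e 0 < e (Suc 0), e (Suc 0) < e 0, e 0 = 0, g (\<lambda>i. e (Suc (Suc i))) E (e 0)))"
    by (rule mso_fun_map2[OF mso_fun_of_bool[OF mso_less] mso_fun_map2[OF mso_fun_of_bool[OF mso_less]
        mso_fun_map2[OF mso_fun_of_bool[OF mso_eq_0] g, of Pair], of Pair], of Pair])
  have T1: "T d (int n) f j = (\<lambda>(lt, gt, z, x).
      (2 * (if lt then fst x else 0) + d * (if lt \<or> gt then 0 else 1), 2 * (if z \<and> \<not> lt then 0 else snd x)))
      (j < n, n < j, j = 0, f j)" for d n f j
    by (auto simp: T_def comb_def trunc_def unit_word_def)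
  have T2: "T d (- int n) f j = (\<lambda>(lt, gt, z, x).
      (d * (if z \<and> \<not> lt \<and> \<not> gt then 1 else 0),
       2 * (if gt then snd x else 0) + d * (if lt \<or> gt \<or> z then 0 else 1)))
      (j < n, n < j, j = 0, f j)" for d n f j
    by (auto simp: T_def comb_def trunc_def unit_word_def)
  have w1: "mso_word (\<lambda>e E. T d (int (e 0)) (g (\<lambda>i. e (Suc i)) E))" for d
    unfolding mso_word_def T1 by (rule mso_fun_map[OF cmp])
  have w2: "mso_word (\<lambda>e E. T d (- int (e 0)) (g (\<lambda>i. e (Suc i)) E))" for d
    unfolding mso_word_def T2 by (rule mso_fun_map[OF cmp])
  have e: "mso (\<lambda>e E. pos d (int (e 0)) (g (\<lambda>i. e (Suc i)) E))"
    "mso (\<lambda>e E. pos d (- int (e 0)) (g (\<lambda>i. e (Suc i)) E))" for d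
    unfolding pos_def by (rule mso_nonneg[OF w1], rule mso_nonneg[OF w2])
  have all_int: "(\<forall>z::int. Q z) \<longleftrightarrow> (\<forall>n. Q (int n) \<and> Q (- int n))" for Q
  proof (intro iffI allI)
    fix z assume "\<forall>n. Q (int n) \<and> Q (- int n)"
    then show "Q z" by (cases z rule: int_cases2) simp_all
  qed simp
  have pos_iff: "pos d z f \<longleftrightarrow> 0 \<le> vl (comb 2 d (trunc z f) (unit_word z))" if "fin f" for d z f
    using that unfolding pos_def T_def by (simp add: fin_comb fin_trunc fin_unit)
  have "canonical f \<longleftrightarrow> fin f \<and> snd (f 0) = 0 \<and>
      (\<forall>n. (pos 1 (int n) f \<and> \<not> pos (- 1) (int n) f) \<and> (pos 1 (- int n) f \<and> \<not> pos (- 1) (- int n) f))" for f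
    unfolding canonical_def all_int by (cases "fin f") (simp_all only: pos_iff simp_thms)
  moreover have "mso (\<lambda>e E. fin (g e E) \<and> snd (g e E 0) = 0 \<and>
      (\<forall>n. (pos 1 (int n) (g e E) \<and> \<not> pos (- 1) (int n) (g e E)) \<and>
        (pos 1 (- int n) (g e E) \<and> \<not> pos (- 1) (- int n) (g e E))))"
    by (intro mso_conj mso_fin assms mso_allN mso_not e)
      (rule mso_of_fun[OF mso_fun_nth_0[OF assms]])
  ultimately show ?thesis by (simp only:)
qed

lemma mso_Ints:
  assumes "mso_word g"
  shows "mso (\<lambda>e E. fin (g e E) \<and> vl (g e E) \<in> \<int>)"
proof -
  have "fin f \<and> vl f \<in> \<int> \<longleftrightarrow> (\<exists>h. (\<forall>n. h n \<in> {-t..t} \<times> {-t..t}) \<and>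
      fin f \<and> fin h \<and> fin (flip h) \<and> (fin (comb 1 (- 1) f h) \<and> vl (comb 1 (- 1) f h) = 0) \<and>
      (fin (comb 1 (- 1) f (flip h)) \<and> vl (comb 1 (- 1) f (flip h)) = 0))" if "bnd f" for f
  proof -
    have "bnd h" if "\<forall>n. h n \<in> {-t..t} \<times> {-t..t}" for h
      by (rule bnd_of_digits[of _ t]) (use that in blast)
    with that have "fin f \<and> (\<forall>n. h n \<in> {-t..t} \<times> {-t..t}) \<and> fin h \<and> fin (flip h) \<and> vl h = vl f \<and> vl (flip h) = vl f
        \<longleftrightarrow> (\<forall>n. h n \<in> {-t..t} \<times> {-t..t}) \<and>
      fin f \<and> fin h \<and> fin (flip h) \<and> (fin (comb 1 (- 1) f h) \<and> vl (comb 1 (- 1) f h) = 0) \<and>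
      (fin (comb 1 (- 1) f (flip h)) \<and> vl (comb 1 (- 1) f (flip h)) = 0)" for h
      by (auto simp: vl_comb fin_comb bnd_flip)
    then show ?thesis unfolding Ints_iff ex_simps(2)[symmetric] by (intro ex_cong1)
  qed
  note eq = this[OF mso_word_bnd[OF assms]]
  have "mso (\<lambda>e E. \<exists>h. (\<forall>n. h n \<in> {-t..t} \<times> {-t..t}) \<and> fin (g e E) \<and> fin h \<and> fin (flip h) \<and>
      (fin (comb 1 (- 1) (g e E) h) \<and> vl (comb 1 (- 1) (g e E) h) = 0) \<and>
      (fin (comb 1 (- 1) (g e E) (flip h)) \<and> vl (comb 1 (- 1) (g e E) (flip h)) = 0))"
  proof (rule mso_ex_word)
    fix r :: "(nat \<Rightarrow> nat set) \<Rightarrow> nat \<Rightarrow> int \<times> int" and L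
    assume r: "mso_word (\<lambda>e. r)"
    have g: "mso_word (\<lambda>e E. g e (\<lambda>i. E (i + L)))"
      using mso_word_rename[OF assms, of id "\<lambda>i. i + L"] by simp
    show "mso (\<lambda>e E. fin (g e (\<lambda>i. E (i + L))) \<and> fin (r E) \<and> fin (flip (r E)) \<and>
      (fin (comb 1 (- 1) (g e (\<lambda>i. E (i + L))) (r E)) \<and> vl (comb 1 (- 1) (g e (\<lambda>i. E (i + L))) (r E)) = 0) \<and>
      (fin (comb 1 (- 1) (g e (\<lambda>i. E (i + L))) (flip (r E))) \<and>
        vl (comb 1 (- 1) (g e (\<lambda>i. E (i + L))) (flip (r E))) = 0))"
      by (rule mso_conj[OF mso_fin[OF g] mso_conj[OF mso_fin[OF r] mso_conj[OF mso_fin[OF mso_word_flip[OF r]]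
          mso_conj[OF mso_zero[OF mso_word_comb[OF g r]] mso_zero[OF mso_word_comb[OF g mso_word_flip[OF r]]]]]]])
  qed simp
  then show ?thesis unfolding eq .
qed

text \<open>As m is nonzero, x = z a holds iff m x = n z + k \<beta> z. The word h codes the integer
  z, certified through its reversal, and \<open>shift_up\<close> supplies \<beta> z, so one zero
  test of \<open>C f h\<close> remains.\<close>

lemma mso_Ints_multiple:
  fixes a :: real and m n k :: int
  assumes "mso_word g" "m \<noteq> 0" "m * a = n + k * \<beta>"
  shows "mso (\<lambda>e E. fin (g e E) \<and> (\<exists>z::int. vl (g e E) = z * a))"
proof -
  define C where "C f h = comb 1 (- k) (comb m (- n) f h) (shift_up h)" for f h
  have "fin f \<and> (\<exists>z::int. vl f = z * a) \<longleftrightarrow> (\<exists>h. (\<forall>n. h n \<in> {-t..t} \<times> {-t..t}) \<and>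
      fin f \<and> fin h \<and> fin (flip h) \<and> (fin (comb 1 (- 1) h (flip h)) \<and> vl (comb 1 (- 1) h (flip h)) = 0) \<and>
      (fin (C f h) \<and> vl (C f h) = 0))" if "bnd f" for f
  proof -
    have bnd: "bnd h" if "\<forall>n. h n \<in> {-t..t} \<times> {-t..t}" for h
      by (rule bnd_of_digits[of _ t]) (use that in blast)
    have C: "fin (C f h)" "vl (C f h) = m * vl f - vl h * (m * a)" if "fin f" "fin h" "bnd h" for h
      unfolding C_def assms(3) using that \<open>bnd f\<close>
      by (simp_all add: fin_comb bnd_comb vl_comb fin_bnd_vl_shift_up algebra_simps)
    show ?thesis
    proof
      assume l: "fin f \<and> (\<exists>z::int. vl f = z * a)"
      then obtain z :: int where z: "vl f = z * a" by blast
      obtain h where h: "\<forall>n. h n \<in> {-t..t} \<times> {-t..t}" "fin h" "fin (flip h)" "vl h = z" "vl (flip h) = z"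
        using Ints_iff[of "of_int z"] by auto
      have "vl (C f h) = 0" using C(2)[of h] l h bnd z by simp
      moreover have "vl (comb 1 (- 1) h (flip h)) = 0" using h bnd by (simp add: vl_comb bnd_flip)
      ultimately show "\<exists>h. (\<forall>n. h n \<in> {-t..t} \<times> {-t..t}) \<and>
        fin f \<and> fin h \<and> fin (flip h) \<and> (fin (comb 1 (- 1) h (flip h)) \<and> vl (comb 1 (- 1) h (flip h)) = 0) \<and>
        (fin (C f h) \<and> vl (C f h) = 0)"
        using h l C(1)[of h] bnd by (intro exI[of _ h]) (simp add: fin_comb)
    next
      assume "\<exists>h. (\<forall>n. h n \<in> {-t..t} \<times> {-t..t}) \<and>
        fin f \<and> fin h \<and> fin (flip h) \<and> (fin (comb 1 (- 1) h (flip h)) \<and> vl (comb 1 (- 1) h (flip h)) = 0) \<and>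
        (fin (C f h) \<and> vl (C f h) = 0)"
      then obtain h where h: "\<forall>n. h n \<in> {-t..t} \<times> {-t..t}" "fin f" "fin h" "fin (flip h)"
        "vl (comb 1 (- 1) h (flip h)) = 0" "vl (C f h) = 0" by (elim exE conjE)
      have "vl (flip h) = vl h" using h bnd by (simp add: vl_comb bnd_flip)
      then have "vl h \<in> \<int>" unfolding Ints_iff using h by blast
      then obtain z :: int where z: "vl h = z" by (elim Ints_cases)
      have "vl f = vl h * a" using C(2)[of h] h bnd assms(2) by simp
      with z h(2) show "fin f \<and> (\<exists>z::int. vl f = z * a)" by auto
    qed
  qed
  note eq = this[OF mso_word_bnd[OF assms(1)]]
  have "mso (\<lambda>e E. \<exists>h. (\<forall>n. h n \<in> {-t..t} \<times> {-t..t}) \<and> fin (g e E) \<and> fin h \<and> fin (flip h) \<and>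
      (fin (comb 1 (- 1) h (flip h)) \<and> vl (comb 1 (- 1) h (flip h)) = 0) \<and>
      (fin (C (g e E) h) \<and> vl (C (g e E) h) = 0))"
  proof (rule mso_ex_word)
    fix r :: "(nat \<Rightarrow> nat set) \<Rightarrow> nat \<Rightarrow> int \<times> int" and L
    assume r: "mso_word (\<lambda>e. r)"
    have g: "mso_word (\<lambda>e E. g e (\<lambda>i. E (i + L)))"
      using mso_word_rename[OF assms(1), of id "\<lambda>i. i + L"] by simp
    have C: "mso_word (\<lambda>e E. C (g e (\<lambda>i. E (i + L))) (r E))"
      unfolding C_def by (rule mso_word_comb[OF mso_word_comb[OF g r] mso_word_shift_up[OF r]])
    show "mso (\<lambda>e E. fin (g e (\<lambda>i. E (i + L))) \<and> fin (r E) \<and> fin (flip (r E)) \<and>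
      (fin (comb 1 (- 1) (r E) (flip (r E))) \<and> vl (comb 1 (- 1) (r E) (flip (r E))) = 0) \<and>
      (fin (C (g e (\<lambda>i. E (i + L))) (r E)) \<and> vl (C (g e (\<lambda>i. E (i + L))) (r E)) = 0))"
      by (rule mso_conj[OF mso_fin[OF g] mso_conj[OF mso_fin[OF r] mso_conj[OF mso_fin[OF mso_word_flip[OF r]]
          mso_conj[OF mso_zero[OF mso_word_comb[OF r mso_word_flip[OF r]]] mso_zero[OF C]]]]])
  qed simp
  then show ?thesis unfolding eq .
qed

end

lemma tuples_append: "tuples (v @ w) = {x @ y | x y. x \<in> tuples v \<and> y \<in> tuples w}"
proof (intro set_eqI iffI)
  fix z assume "z \<in> tuples (v @ w)"
  then have "map srt_of z = v @ w" by (simp add: tuples_def)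
  then have "z = take (length v) z @ drop (length v) z" "map srt_of (take (length v) z) = v"
    "map srt_of (drop (length v) z) = w" by (simp_all add: take_map[symmetric] drop_map[symmetric])
  then show "z \<in> {x @ y | x y. x \<in> tuples v \<and> y \<in> tuples w}" unfolding tuples_def by blast
qed (auto simp: tuples_def)

theorem theoremC:
  fixes a :: real
  assumes "quadratic a"
  shows "\<exists>A. definable_structure A \<and> isomorphic A (R_struct a)"
proof -
  obtain t m n k :: int and \<beta> :: real
    where base: "unit_base t \<beta>" and mnk: "m \<noteq> 0" "m * a = n + k * \<beta>"
    using quadratic_unit[OF assms] .
  interpret unit_base t \<beta> by (rule base)
  define l where "l = nat t"
  \<comment> \<open>This interval contains {-t..t} because t < \<open>2 ^ l\<close>. Its size is a
    power of two, so pairs of digits correspond exactly to the subsets of \<open>{..<L}\<close>: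
    every tuple of sets is a word, and distinct tuples are distinct words.\<close>
  define \<Delta> where "\<Delta> = {- (2 ^ l)..<(2 ^ l :: int)}"
  define L where "L = Suc l + Suc l"
  define w where "w = replicate L SSet"
  have "int l < 2 ^ l" using less_exp[of l] by (metis of_nat_less_numeral_power_cancel_iff)
  then have t_\<Delta>: "{-t..t} \<times> {-t..t} \<subseteq> \<Delta> \<times> \<Delta>" using t_ge_3 by (auto simp: \<Delta>_def l_def)
  have "card (\<Delta> \<times> \<Delta>) = card (Pow {..<L})"
    by (simp add: \<Delta>_def L_def card_Pow card_cartesian_product nat_power_eq nat_mult_distrib power_add)
  then obtain \<delta> where \<delta>: "bij_betw \<delta> (Pow {..<L}) (\<Delta> \<times> \<Delta>)"
    using finite_same_card_bij[of "Pow {..<L}" "\<Delta> \<times> \<Delta>"] by (auto simp: \<Delta>_def)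
  define cw where "cw k E n = \<delta> (letter L k E n)" for k E n
  have cw: "mso_word (\<lambda>e. cw k)" for k unfolding cw_def by (rule mso_word_map[OF mso_word_letter])
  have cw_bnd: "bnd (cw k E)" for k E using mso_word_bnd[OF cw] by blast
  have cw_cong: "cw k E = cw k' E'" if "\<And>i. i < L \<Longrightarrow> E (k + i) = E' (k' + i)" for k k' E E'
    using that by (auto simp: cw_def letter_def fun_eq_iff intro!: arg_cong[of _ _ \<delta>])
  define env where "env v i = the_set (v ! i)" for v :: "elem list" and i
  define word where "word v = cw 0 (env v)" for v
  define U where "U = {v \<in> tuples w. canonical (word v)}"
  define val where "val v = vl (word v)" for v
  have len: "length v = L" if "v \<in> tuples w" for v
    using that by (auto simp: tuples_def w_def dest: arg_cong[of _ _ length])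
  have word_inj: "x = y" if "x \<in> tuples w" "y \<in> tuples w" "word x = word y" for x y
  proof (rule nth_equalityI)
    show "length x = length y" using that len by simp
    fix i assume "i < length x"
    then have i: "i < L" using that len by simp
    have srt: "srt_of (v ! i) = SSet" if "v \<in> tuples w" for v
      using that i len[OF that] by (auto simp: tuples_def w_def dest: arg_cong[of _ _ "\<lambda>z. z ! i"])
    have "letter L 0 (env x) n = letter L 0 (env y) n" for n
      using fun_cong[OF that(3), of n] \<delta>
      by (auto simp: word_def cw_def letter_def bij_betw_def dest!: inj_onD)
    then have "n \<in> env x i \<longleftrightarrow> n \<in> env y i" for n
      using i by (auto simp: letter_def set_eq_iff)
    then have "the_set (x ! i) = the_set (y ! i)" by (auto simp: env_def)
    with srt[OF that(1)] srt[OF that(2)] show "x ! i = y ! i" by (cases "x ! i"; cases "y ! i") auto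
  qed
  have word_surj: "\<exists>v\<in>tuples w. word v = f" if f: "\<And>n. f n \<in> \<Delta> \<times> \<Delta>" for f
  proof -
    define c where "c n = inv_into (Pow {..<L}) \<delta> (f n)" for n
    have c: "c n \<in> Pow {..<L}" "\<delta> (c n) = f n" for n
    proof -
      have "\<delta> ` Pow {..<L} = \<Delta> \<times> \<Delta>" using \<delta> by (rule bij_betw_imp_surj_on)
      then have *: "f n \<in> \<delta> ` Pow {..<L}" using f[of n] by (simp only:)
      show "c n \<in> Pow {..<L}" unfolding c_def by (rule inv_into_into[OF *])
      show "\<delta> (c n) = f n" unfolding c_def by (rule f_inv_into_f[OF *])
    qed
    define v where "v = map (\<lambda>i. ESet {n. i \<in> c n}) [0..<L]"
    have "v \<in> tuples w"
      unfolding tuples_def w_def v_def by (simp add: list_eq_iff_nth_eq)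
    moreover have "letter L 0 (env v) n = c n" for n
    proof -
      have "i < L" if "i \<in> c n" for i using c(1)[of n] that by blast
      then show ?thesis unfolding letter_def env_def v_def by auto
    qed
    then have "word v = f" unfolding word_def cw_def by (intro ext) (simp only: c(2))
    ultimately show ?thesis by (intro bexI)
  qed
  have bij: "bij_betw val U UNIV"
    unfolding bij_betw_def
  proof
    show "inj_on val U"
      by (rule inj_onI) (auto simp: U_def val_def word_def intro!: word_inj[unfolded word_def] canonical_unique cw_bnd)
    have "x \<in> val ` U" for x
    proof -
      obtain f where f: "canonical f" "vl f = x" "\<forall>n. f n \<in> {-t..t} \<times> {-t..t}"
        using canonical_exists by blast
      obtain v where v: "v \<in> tuples w" "word v = f" using word_surj[of f] f(3) t_\<Delta> by blast
      then have "v \<in> U" "val v = x" using f by (simp_all add: U_def val_def)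
      then show ?thesis by blast
    qed
    then show "val ` U = UNIV" by blast
  qed
  define plus where "plus x y = inv_into U val (val x + val y)" for x y
  have plus: "plus x y \<in> U" "val (plus x y) = val x + val y" for x y
    using bij unfolding plus_def bij_betw_def by (auto intro: inv_into_into f_inv_into_f)
  define A where "A = \<lparr>univ = U, lt = (\<lambda>x y. val x < val y), add = plus,
    pred1 = {v \<in> U. val v \<in> \<int>}, pred2 = {v \<in> U. val v \<in> {of_int z * a | z. True}}\<rparr>"
  have "isomorphic A (R_struct a)"
    unfolding isomorphic_def by (rule exI[of _ val]) (auto simp: A_def R_struct_def bij plus)
  moreover have "definable_structure A"
    unfolding definable_structure_def
  proof (intro conjI exI[of _ w])
    show "is_structure A" by (auto simp: is_structure_def A_def plus)
    have fin_cw: "fin (cw k E)" if "canonical (cw k E)" for k E using that by (simp add: canonical_def)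
    have U_iff: "v \<in> U \<longleftrightarrow> v \<in> tuples w \<and> canonical (cw 0 (env v))" for v
      by (simp add: U_def word_def)
    have env_append: "cw 0 (env (x @ y)) = cw 0 (env x)" "cw (L + k) (env (x @ y)) = cw k (env y)"
      if "x \<in> tuples w" for x y k
      by (rule cw_cong; use len[OF that] in \<open>simp add: env_def nth_append\<close>)+
    have "definable w {v \<in> tuples w. canonical (cw 0 (env v))}"
      unfolding w_def env_def
      by (rule definable_setsI[OF mso_canonical[OF cw]]) (metis add_0 cw_cong)
    then show "definable w (univ A)" by (simp add: A_def U_def word_def)
    have "definable w {v \<in> tuples w. canonical (cw 0 (env v)) \<and> fin (cw 0 (env v)) \<and> vl (cw 0 (env v)) \<in> \<int>}"
      unfolding w_def env_def
      by (rule definable_setsI[OF mso_conj[OF mso_canonical[OF cw] mso_Ints[OF cw]]]) (metis add_0 cw_cong)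
    also have "{v \<in> tuples w. canonical (cw 0 (env v)) \<and> fin (cw 0 (env v)) \<and> vl (cw 0 (env v)) \<in> \<int>} = pred1 A"
      using fin_cw by (auto simp: A_def U_def val_def word_def)
    finally show "definable w (pred1 A)" .
    have "definable w {v \<in> tuples w. canonical (cw 0 (env v)) \<and>
        fin (cw 0 (env v)) \<and> (\<exists>z::int. vl (cw 0 (env v)) = z * a)}"
      unfolding w_def env_def
      by (rule definable_setsI[OF mso_conj[OF mso_canonical[OF cw] mso_Ints_multiple[OF cw mnk]]])
        (metis add_0 cw_cong)
    also have "{v \<in> tuples w. canonical (cw 0 (env v)) \<and>
        fin (cw 0 (env v)) \<and> (\<exists>z::int. vl (cw 0 (env v)) = z * a)} = pred2 A"
      using fin_cw by (auto simp: A_def U_def val_def word_def)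
    finally show "definable w (pred2 A)" .
    \<comment> \<open>x < y is the negation of 0 \<le> x - y. Canonical words have finite
      differences, so the negation affects only the inequality.\<close>
    define lt_pred where "lt_pred E \<longleftrightarrow> canonical (cw 0 E) \<and> canonical (cw L E) \<and>
      \<not> (fin (comb 1 (- 1) (cw 0 E) (cw L E)) \<and> 0 \<le> vl (comb 1 (- 1) (cw 0 E) (cw L E)))" for E
    have "definable (replicate (L + L) SSet) {v \<in> tuples (replicate (L + L) SSet). lt_pred (env v)}"
      unfolding env_def
    proof (rule definable_setsI)
      show "mso (\<lambda>e. lt_pred)" unfolding lt_pred_def
        by (intro mso_conj mso_canonical mso_not mso_nonneg mso_word_comb cw)
      fix E E' :: "nat \<Rightarrow> nat set" assume "\<And>i. i < L + L \<Longrightarrow> E i = E' i"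
      then have "cw 0 E = cw 0 E'" "cw L E = cw L E'" by (intro cw_cong; simp)+
      then show "lt_pred E \<longleftrightarrow> lt_pred E'" by (simp add: lt_pred_def)
    qed
    moreover have "lt_pred (env (x @ y)) \<longleftrightarrow> x \<in> U \<and> y \<in> U \<and> val x < val y"
      if "x \<in> tuples w" "y \<in> tuples w" for x y
      using that env_append(1)[OF that(1), of y] env_append(2)[OF that(1), of 0 y] fin_cw cw_bnd
      by (auto simp: lt_pred_def U_iff val_def word_def vl_comb fin_comb)
    then have "{v \<in> tuples (w @ w). lt_pred (env v)} = {x @ y | x y. x \<in> U \<and> y \<in> U \<and> val x < val y}"
      unfolding tuples_append by (auto simp: U_iff) 
    ultimately show "definable (w @ w) {x @ y | x y. x \<in> univ A \<and> y \<in> univ A \<and> lt A x y}"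
      by (simp add: A_def w_def replicate_add)
    define add_pred where "add_pred E \<longleftrightarrow> canonical (cw 0 E) \<and> canonical (cw L E) \<and> canonical (cw (L + L) E) \<and>
      fin (comb 1 (- 1) (comb 1 1 (cw 0 E) (cw L E)) (cw (L + L) E)) \<and>
      vl (comb 1 (- 1) (comb 1 1 (cw 0 E) (cw L E)) (cw (L + L) E)) = 0" for E
    have "definable (replicate (L + L + L) SSet) {v \<in> tuples (replicate (L + L + L) SSet). add_pred (env v)}"
      unfolding env_def
    proof (rule definable_setsI)
      show "mso (\<lambda>e. add_pred)" unfolding add_pred_def
        by (intro mso_conj[OF mso_canonical mso_conj[OF mso_canonical mso_conj[OF mso_canonical mso_zero]]]
            mso_word_comb cw)
      fix E E' :: "nat \<Rightarrow> nat set" assume "\<And>i. i < L + L + L \<Longrightarrow> E i = E' i"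
      then have "cw 0 E = cw 0 E'" "cw L E = cw L E'" "cw (L + L) E = cw (L + L) E'"
        by (intro cw_cong; simp)+
      then show "add_pred E \<longleftrightarrow> add_pred E'" by (simp add: add_pred_def)
    qed
    \<comment> \<open>The relation only asks for a canonical z with the right value; injectivity of
      \<open>val\<close> then makes it equal to the sum.\<close>
    moreover have add_iff: "add_pred (env (x @ y @ z)) \<longleftrightarrow> x \<in> U \<and> y \<in> U \<and> z = plus x y"
      if "x \<in> tuples w" "y \<in> tuples w" "z \<in> tuples w" for x y z
    proof -
      have "add_pred (env (x @ y @ z)) \<longleftrightarrow> x \<in> U \<and> y \<in> U \<and> z \<in> U \<and> val x + val y = val z"
        using that env_append(1)[OF that(1), of "y @ z"] env_append(2)[OF that(1), of 0 "y @ z"]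
          env_append(2)[OF that(1), of L "y @ z"] env_append(1)[OF that(2), of z]
          env_append(2)[OF that(2), of 0 z] fin_cw cw_bnd
        by (auto simp: add_pred_def U_iff val_def word_def vl_comb fin_comb bnd_comb)
      also have "\<dots> \<longleftrightarrow> x \<in> U \<and> y \<in> U \<and> z = plus x y"
        using plus[of x y] bij by (auto simp: bij_betw_def dest: inj_onD)
      finally show ?thesis .
    qed
    have "{v \<in> tuples (w @ w @ w). add_pred (env v)} = {x @ y @ plus x y | x y. x \<in> U \<and> y \<in> U}"
    proof (intro set_eqI iffI)
      fix v assume "v \<in> {v \<in> tuples (w @ w @ w). add_pred (env v)}"
      then obtain x y z where v: "v = x @ y @ z" "x \<in> tuples w" "y \<in> tuples w" "z \<in> tuples w" "add_pred (env v)"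
        unfolding tuples_append by blast
      with add_iff[of x y z] show "v \<in> {x @ y @ plus x y | x y. x \<in> U \<and> y \<in> U}" by auto
    next
      fix v assume "v \<in> {x @ y @ plus x y | x y. x \<in> U \<and> y \<in> U}"
      then obtain x y where v: "v = x @ y @ plus x y" "x \<in> U" "y \<in> U" by blast
      then have "x \<in> tuples w" "y \<in> tuples w" "plus x y \<in> tuples w" using plus(1)[of x y] by (simp_all add: U_iff)
      with v add_iff show "v \<in> {v \<in> tuples (w @ w @ w). add_pred (env v)}"
        unfolding tuples_append by blast
    qed
    ultimately show "definable (w @ w @ w) {x @ y @ add A x y | x y. x \<in> univ A \<and> y \<in> univ A}"
      by (simp add: A_def w_def replicate_add)
  qed
  ultimately show ?thesis by blast
qed

end
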